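(* Let $r\ge2$ be a fixed integer, $a>b>0$ fixed, and $n=rK$. In the stochastic block model with $r$ clusters of equal size $K$, let $\widehat Z_{\mathrm{SDP}}$ be the solution of $$\max_Z\ \langle A,Z\rangle\quad\text{s.t.}\quad Z\succeq0,\ \ Z_{ii}=1\ (i\in[n]),\ \ Z_{ij}\ge0\ (i,j\in[n]),\ \ Z\mathbf 1=K\mathbf 1.$$ If $\sqrt a-\sqrt b>\sqrt r$, then $\min_{Z^*\in\mathcal Z_{n,r}}\mathbb P\{\widehat Z_{\mathrm{SDP}}=Z^*\}\ge1-n^{-\Omega(1)}$ as $n\to\infty$ (where $\widehat Z_{\mathrm{SDP}}=Z^*$ means $Z^*$ is the unique optimal solution).
   Context: SBM with $r$ equal-sized clusters: the vertex set $[n]$ is partitioned into clusters $C_1,\dots,C_r$ each of size $K$, with indicator vectors $\xi^*_k\in\{0,1\}^n$. Each pair $\{i,j\}$ is independently connected with probability $p=a\log n/n$ if $i,j$ are in the same cluster and $q=b\log n/n$ otherwise; $A$ is the adjacency matrix. $Z^*=\sum_{k=1}^r\xi^*_k(\xi^*_k)^\top$, and $\mathcal Z_{n,r}=\{\sum_{k=1}^r\xi_k\xi_k^\top:\xi_k\in\{0,1\}^n,\ \xi_k^\top\mathbf 1=K,\ \xi_k^\top\xi_{k'}=0\ (k\ne k')\}$. *)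

theory Defs
  imports "HOL-Probability.Probability"
begin

text \<open>Vertices are 0..<n. Matrices are functions nat => nat => real, only entries with
indices < n matter.\<close>

definition vpairs :: "nat \<Rightarrow> (nat \<times> nat) set" where
  "vpairs n = {(i, j). i < j \<and> j < n}"

definition balanced_labelling :: "nat \<Rightarrow> nat \<Rightarrow> (nat \<Rightarrow> nat) \<Rightarrow> bool" where
  "balanced_labelling r K \<sigma> \<longleftrightarrow>
     (\<forall>i < r * K. \<sigma> i < r) \<and> (\<forall>k < r. card {i. i < r * K \<and> \<sigma> i = k} = K)"

text \<open>Z* = sum_k xi_k xi_k^T: entry 1 iff i, j are in the same cluster.\<close>
definition cluster_matrix :: "(nat \<Rightarrow> nat) \<Rightarrow> nat \<Rightarrow> nat \<Rightarrow> real" where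
  "cluster_matrix \<sigma> i j = (if \<sigma> i = \<sigma> j then 1 else 0)"

definition sbm :: "nat \<Rightarrow> real \<Rightarrow> real \<Rightarrow> (nat \<Rightarrow> nat) \<Rightarrow> (nat \<times> nat \<Rightarrow> bool) pmf" where
  "sbm n a b \<sigma> = Pi_pmf (vpairs n) False
     (\<lambda>(i, j). bernoulli_pmf (if \<sigma> i = \<sigma> j then a * ln n / n else b * ln n / n))"

text \<open>Adjacency matrix of a graph given by its edge indicator on pairs i<j.\<close>
definition adj_matrix :: "(nat \<times> nat \<Rightarrow> bool) \<Rightarrow> nat \<Rightarrow> nat \<Rightarrow> real" where
  "adj_matrix G i j = (if G (i, j) \<or> G (j, i) then 1 else 0)"

definition mat_inner :: "nat \<Rightarrow> (nat \<Rightarrow> nat \<Rightarrow> real) \<Rightarrow> (nat \<Rightarrow> nat \<Rightarrow> real) \<Rightarrow> real" where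
  "mat_inner n A Z = (\<Sum>i<n. \<Sum>j<n. A i j * Z i j)"

definition psd :: "nat \<Rightarrow> (nat \<Rightarrow> nat \<Rightarrow> real) \<Rightarrow> bool" where
  "psd n Z \<longleftrightarrow> (\<forall>i<n. \<forall>j<n. Z i j = Z j i) \<and>
     (\<forall>x :: nat \<Rightarrow> real. 0 \<le> (\<Sum>i<n. \<Sum>j<n. x i * Z i j * x j))"

definition sdp_feasible :: "nat \<Rightarrow> nat \<Rightarrow> (nat \<Rightarrow> nat \<Rightarrow> real) \<Rightarrow> bool" where
  "sdp_feasible n K Z \<longleftrightarrow> psd n Z \<and> (\<forall>i<n. Z i i = 1) \<and>
     (\<forall>i<n. \<forall>j<n. 0 \<le> Z i j) \<and> (\<forall>i<n. (\<Sum>j<n. Z i j) = real K)"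

definition sdp_unique_opt :: "nat \<Rightarrow> nat \<Rightarrow> (nat \<Rightarrow> nat \<Rightarrow> real) \<Rightarrow> (nat \<Rightarrow> nat \<Rightarrow> real) \<Rightarrow> bool" where
  "sdp_unique_opt n K A Z0 \<longleftrightarrow> sdp_feasible n K Z0 \<and>
     (\<forall>Z. sdp_feasible n K Z \<and> (\<exists>i<n. \<exists>j<n. Z i j \<noteq> Z0 i j)
          \<longrightarrow> mat_inner n A Z < mat_inner n A Z0)"

end

theory Submission
  imports Defs "HOL-Real_Asymp.Real_Asymp"
begin

text \<open>A dual certificate reduces the theorem to three properties of the graph, with \<open>M\<close> the centred
  adjacency matrix: every vertex has at least \<open>\<eta> log n\<close> more neighbours in its own cluster than in any
  other cluster; all degrees are \<open>O(log n)\<close>; and the sum of \<open>M\<close> over \<open>S \<times> T\<close> is at most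
  \<open>\<alpha> log n sqrt (|S| |T|)\<close> for all vertex sets \<open>S, T\<close>, with \<open>\<alpha>\<close> small compared to \<open>\<eta>\<close>.

  The first property is where \<open>sqrt a - sqrt b > sqrt r\<close> enters, through the Chernoff bound with tilt
  \<open>sqrt (a / b)\<close>. The other two hold by Chernoff and union bounds. Since the certificate has slack
  of order \<open>log n\<close>, the spectral norm of \<open>M\<close> is only needed to be a small multiple of \<open>log n\<close>, rather
  than \<open>O(sqrt (log n))\<close>, and this follows from the degree and discrepancy bounds alone by
  a Bilu--Linial argument.\<close>

section \<open>Quadratic forms and discrepancy\<close>

text \<open>The slack is the surplus \<delta> of \<open>(sqrt a - sqrt b)\<^sup>2 / r\<close> over
  1: the union bound over vertices uses up the 1, half of \<delta> pays for the margin \<eta> log n,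
  and the other half is left as failure exponent.

  The discrepancy bound cannot come from a union bound over all pairs: the tail for one pair has
  exponent of order log n sqrt (|S| |T|), whereas the choice of a small T alone costs about |T| log
  n, which is more when |S| is much smaller than |T|. Unbalanced pairs are therefore treated
  deterministically through the degrees, and only pairs of comparable sizes need probability.

  The constants avoid circularity by being fixed in this order: \<eta> and the degree constant, then
  the dyadic range R, which depends on both, and only then \<alpha>, which depends on \<eta> and
  R.\<close>

lemma psd_Suc_extend:
  assumes "psd (Suc n) Z"
  shows "0 \<le> (\<Sum>i<n. \<Sum>j<n. x i * Z i j * x j) + 2 * y * (\<Sum>i<n. Z i n * x i) + Z n n * y\<^sup>2"
proof -
  define x' where "x' i = (if i = n then y else x i)" for i
  have sym: "Z n j = Z j n" if "j < n" for j
    using assms that unfolding psd_def by auto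
  have "0 \<le> (\<Sum>i<Suc n. \<Sum>j<Suc n. x' i * Z i j * x' j)"
    using assms unfolding psd_def by blast
  also have "\<dots> = (\<Sum>i<n. \<Sum>j<n. x i * Z i j * x j) + (\<Sum>i<n. x i * Z i n * y)
      + (\<Sum>j<n. y * Z n j * x j) + y * Z n n * y"
    by (simp add: x'_def sum.distrib)
  also have "(\<Sum>j<n. y * Z n j * x j) = (\<Sum>i<n. x i * Z i n * y)"
    by (rule sum.cong) (auto simp: sym)
  also have "(\<Sum>i<n. x i * Z i n * y) = y * (\<Sum>i<n. Z i n * x i)"
    by (simp add: sum_distrib_left mult_ac)
  finally show ?thesis by (simp add: power2_eq_square algebra_simps)
qed

text \<open>Cholesky factorisation by induction: split off the last column as a rank one term and
  factor the Schur complement. It serves to write the pairing of a dual matrix with a feasible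
  \<open>Z\<close> as a sum of quadratic forms.\<close>

lemma psd_gram:
  "psd n Z \<Longrightarrow> \<exists>V. \<forall>i<n. \<forall>j<n. Z i j = (\<Sum>k<n. V k i * V k j)"
proof (induction n arbitrary: Z)
  case 0
  then show ?case by simp
next
  case (Suc n)
  define z where "z = Z n n"
  note ext = psd_Suc_extend[OF Suc.prems]
  have sym: "Z i j = Z j i" if "i < Suc n" "j < Suc n" for i j
    using Suc.prems that unfolding psd_def by auto
  have z0: "z \<ge> 0" using ext[of "\<lambda>_. 0" 1] by (simp add: z_def)
  \<comment> \<open>With a zero diagonal entry the form is affine in the last coordinate
    \<open>y\<close>, so a nonzero slope would make it negative; the chosen \<open>y\<close> gives
    the value -1.\<close>
  have zero: "Z i n = 0" if "z = 0" "i < n" for i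
  proof (rule ccontr)
    assume nz: "Z i n \<noteq> 0"
    define x :: "nat \<Rightarrow> real" where "x j = (if j = i then 1 else 0)" for j
    define Q where "Q = (\<Sum>i<n. \<Sum>j<n. x i * Z i j * x j)"
    have s: "(\<Sum>j<n. Z j n * x j) = Z i n" using that by (simp add: x_def if_distrib cong: if_cong)
    have "0 \<le> Q + 2 * y * Z i n" for y
      using ext[of x y] s that(1) by (simp add: Q_def z_def)
    from this[of "- (Q + 1) / (2 * Z i n)"] nz show False by (simp add: field_simps)
  qed
  \<comment> \<open>The Schur complement. For \<open>z = 0\<close> division by zero gives 0, so
    \<open>Z'\<close> is \<open>Z\<close> itself and both cases share the formulas; below, the test
    value \<open>- s / z\<close> minimises the form over the last coordinate.\<close>
  define Z' where "Z' i j = Z i j - Z i n * Z j n / z" for i j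
  have "psd n Z'"
    unfolding psd_def
  proof (intro conjI allI impI)
    fix i j assume "i < n" "j < n"
    then show "Z' i j = Z' j i" using sym by (simp add: Z'_def mult.commute)
  next
    fix x :: "nat \<Rightarrow> real"
    define s where "s = (\<Sum>i<n. Z i n * x i)"
    have "(\<Sum>i<n. \<Sum>j<n. x i * Z' i j * x j)
       = (\<Sum>i<n. \<Sum>j<n. x i * Z i j * x j) - (\<Sum>i<n. \<Sum>j<n. (Z i n * x i) * (Z j n * x j) / z)"
      by (simp add: Z'_def sum_subtractf[symmetric] algebra_simps diff_divide_distrib)
    also have "(\<Sum>i<n. \<Sum>j<n. (Z i n * x i) * (Z j n * x j) / z) = s\<^sup>2 / z"
      by (simp add: s_def power2_eq_square sum_product sum_divide_distrib)
    also have "(\<Sum>i<n. \<Sum>j<n. x i * Z i j * x j) - s\<^sup>2 / z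
        = (\<Sum>i<n. \<Sum>j<n. x i * Z i j * x j) + 2 * (- s / z) * s + z * (- s / z)\<^sup>2"
      by (cases "z = 0") (auto simp: field_simps power2_eq_square)
    finally show "0 \<le> (\<Sum>i<n. \<Sum>j<n. x i * Z' i j * x j)"
      using ext[of x "- s / z"] by (simp add: s_def z_def)
  qed
  from Suc.IH[OF this] obtain V where V: "\<And>i j. i < n \<Longrightarrow> j < n \<Longrightarrow> Z' i j = (\<Sum>k<n. V k i * V k j)"
    by blast
  define W where "W k i = (if k < n then (if i < n then V k i else 0) else Z i n / sqrt z)" for k i
  have "Z i j = (\<Sum>k<Suc n. W k i * W k j)" if "i < Suc n" "j < Suc n" for i j
  proof -
    have "(\<Sum>k<Suc n. W k i * W k j) = (if i < n \<and> j < n then Z' i j else 0) + Z i n * Z j n / z"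
      using z0 by (auto simp: W_def V)
    also have "\<dots> = Z i j"
      using that zero sym[of n j] by (cases "z = 0") (auto simp: Z'_def less_Suc_eq z_def)
    finally show ?thesis by simp
  qed
  then show ?case by blast
qed

section \<open>From discrepancy on sets to quadratic forms\<close>

lemma abs_weighted_sum_le:
  fixes g u :: "'a \<Rightarrow> real"
  assumes "finite S" and u: "\<And>i. i \<in> S \<Longrightarrow> \<bar>u i\<bar> \<le> 1"
    and sub: "\<And>S'. S' \<subseteq> S \<Longrightarrow> \<bar>\<Sum>i\<in>S'. g i\<bar> \<le> c"
  shows "\<bar>\<Sum>i\<in>S. u i * g i\<bar> \<le> 2 * c"
proof -
  have "\<bar>\<Sum>i\<in>S. u i * g i\<bar> \<le> (\<Sum>i\<in>S. \<bar>g i\<bar>)"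
    using u by (intro order.trans[OF sum_abs] sum_mono) (auto simp: abs_mult intro!: mult_left_le_one_le)
  also have "\<dots> = (\<Sum>i\<in>{i\<in>S. g i \<ge> 0}. \<bar>g i\<bar>) + (\<Sum>i\<in>{i\<in>S. \<not> g i \<ge> 0}. \<bar>g i\<bar>)"
    using assms(1) by (subst sum.union_disjoint[symmetric]) (auto intro: sum.cong)
  also have "(\<Sum>i\<in>{i\<in>S. g i \<ge> 0}. \<bar>g i\<bar>) = (\<Sum>i\<in>{i\<in>S. g i \<ge> 0}. g i)"
    by (rule sum.cong) auto
  also have "(\<Sum>i\<in>{i\<in>S. \<not> g i \<ge> 0}. \<bar>g i\<bar>) = - (\<Sum>i\<in>{i\<in>S. \<not> g i \<ge> 0}. g i)"
    by (subst sum_negf[symmetric], rule sum.cong) auto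
  finally show ?thesis
    using sub[of "{i\<in>S. g i \<ge> 0}"] sub[of "{i\<in>S. \<not> g i \<ge> 0}"] by auto
qed

text \<open>Replacing an indicator by weights in [-1, 1] costs a factor 2, since the sum of absolute
  values is the difference of two subset sums, split by sign. Doing this in one variable after the
  other gives 4.\<close>

lemma abs_bilinear_box_le:
  fixes M :: "'a \<Rightarrow> 'b \<Rightarrow> real"
  assumes "finite S" "finite T"
    and u: "\<And>i. i \<in> S \<Longrightarrow> \<bar>u i\<bar> \<le> 1" and v: "\<And>j. j \<in> T \<Longrightarrow> \<bar>v j\<bar> \<le> 1"
    and sub: "\<And>S' T'. S' \<subseteq> S \<Longrightarrow> T' \<subseteq> T \<Longrightarrow> \<bar>\<Sum>i\<in>S'. \<Sum>j\<in>T'. M i j\<bar> \<le> c"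
  shows "\<bar>\<Sum>i\<in>S. \<Sum>j\<in>T. M i j * u i * v j\<bar> \<le> 4 * c"
proof -
  have 1: "\<bar>\<Sum>i\<in>S. u i * (\<Sum>j\<in>T'. M i j)\<bar> \<le> 2 * c" if "T' \<subseteq> T" for T'
    using assms that by (intro abs_weighted_sum_le) auto
  have "\<bar>\<Sum>j\<in>T. v j * (\<Sum>i\<in>S. M i j * u i)\<bar> \<le> 2 * (2 * c)"
  proof (intro abs_weighted_sum_le assms)
    fix T' assume "T' \<subseteq> T"
    from 1[OF this] show "\<bar>\<Sum>j\<in>T'. \<Sum>i\<in>S. M i j * u i\<bar> \<le> 2 * c"
      by (subst sum.swap) (simp add: sum_distrib_left mult_ac)
  qed
  also have "(\<Sum>j\<in>T. v j * (\<Sum>i\<in>S. M i j * u i)) = (\<Sum>i\<in>S. \<Sum>j\<in>T. M i j * u i * v j)"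
    by (subst sum.swap) (simp add: sum_distrib_left mult_ac)
  finally show ?thesis by simp
qed

lemma dyadic_level:
  fixes y :: real
  assumes "y \<noteq> 0"
  shows "2 powr \<lfloor>log 2 \<bar>y\<bar>\<rfloor> \<le> \<bar>y\<bar>" "\<bar>y\<bar> \<le> 2 * 2 powr \<lfloor>log 2 \<bar>y\<bar>\<rfloor>"
proof -
  have y: "\<bar>y\<bar> = 2 powr (log 2 \<bar>y\<bar>)" using assms by simp
  show "2 powr \<lfloor>log 2 \<bar>y\<bar>\<rfloor> \<le> \<bar>y\<bar>" by (subst (2) y, rule powr_mono) auto
  have "\<bar>y\<bar> \<le> 2 powr (1 + \<lfloor>log 2 \<bar>y\<bar>\<rfloor>)"
    by (subst (1) y, rule powr_mono) linarith+
  then show "\<bar>y\<bar> \<le> 2 * 2 powr \<lfloor>log 2 \<bar>y\<bar>\<rfloor>" by (simp add: powr_add)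
qed

text \<open>A Bilu--Linial type converse of the expander mixing lemma: split the index pairs by the
  dyadic levels of \<open>x\<close>; pairs of levels at distance at most \<open>R\<close> are controlled by the discrepancy,
  the others by the row sums.\<close>

lemma quadratic_form_le_of_discrepancy:
  fixes M :: "nat \<Rightarrow> nat \<Rightarrow> real" and x :: "nat \<Rightarrow> real" and R :: nat
  assumes sym: "\<And>i j. i < n \<Longrightarrow> j < n \<Longrightarrow> M i j = M j i"
    and row: "\<And>i. i < n \<Longrightarrow> (\<Sum>j<n. \<bar>M i j\<bar>) \<le> d"
    and disc: "\<And>S T. S \<subseteq> {..<n} \<Longrightarrow> T \<subseteq> {..<n} \<Longrightarrow>
      \<bar>\<Sum>i\<in>S. \<Sum>j\<in>T. M i j\<bar> \<le> \<beta> * sqrt (real (card S) * real (card T))"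
    and \<beta>: "\<beta> \<ge> 0"
  shows "(\<Sum>i<n. \<Sum>j<n. M i j * x i * x j) \<le> (16 * \<beta> * (2 * R + 1) + 2 * d / 2 ^ R) * (\<Sum>i<n. (x i)\<^sup>2)"
proof -
  define lev where "lev i = \<lfloor>log 2 \<bar>x i\<bar>\<rfloor>" for i
  \<comment> \<open>Zero entries have no dyadic level: \<open>log 2 0\<close> is only a default
    value.\<close>
  define N where "N = {i. i < n \<and> x i \<noteq> 0}"
  define S where "S k = {i \<in> N. lev i = k}" for k
  define \<Lambda> where "\<Lambda> = lev ` N"
  define w where "w k = (\<Sum>i\<in>S k. (x i)\<^sup>2)" for k
  define F where "F i j = \<bar>M i j\<bar> * ((x i)\<^sup>2 + (x j)\<^sup>2) / 2 ^ R" for i j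
  have finN: "finite N" "N \<subseteq> {..<n}" by (auto simp: N_def)
  have finS: "finite (S k)" "S k \<subseteq> {..<n}" for k using finN by (auto simp: S_def)
  have fin\<Lambda>: "finite \<Lambda>" using finN by (simp add: \<Lambda>_def)
  have group: "(\<Sum>k\<in>\<Lambda>. \<Sum>i\<in>S k. h i) = (\<Sum>i\<in>N. h i)" for h :: "nat \<Rightarrow> real"
    unfolding S_def \<Lambda>_def by (rule sum.group) (use finN in auto)
  have group2: "(\<Sum>k\<in>\<Lambda>. \<Sum>l\<in>\<Lambda>. \<Sum>i\<in>S k. \<Sum>j\<in>S l. h i j) = (\<Sum>i\<in>N. \<Sum>j\<in>N. h i j)"
    for h :: "nat \<Rightarrow> nat \<Rightarrow> real"
  proof -
    have "(\<Sum>k\<in>\<Lambda>. \<Sum>l\<in>\<Lambda>. \<Sum>i\<in>S k. \<Sum>j\<in>S l. h i j) = (\<Sum>k\<in>\<Lambda>. \<Sum>i\<in>S k. \<Sum>l\<in>\<Lambda>. \<Sum>j\<in>S l. h i j)"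
      by (intro sum.cong refl sum.swap)
    then show ?thesis by (simp add: group)
  qed
  have lev: "2 powr k \<le> \<bar>x i\<bar>" "\<bar>x i\<bar> \<le> 2 * 2 powr k" if "i \<in> S k" for i k
    using dyadic_level[of "x i"] that by (auto simp: S_def N_def lev_def)
  \<comment> \<open>This trades cardinalities for mass: the square root in the discrepancy bound is
    just what turns level sizes into the masses \<open>w k\<close>.\<close>
  have wge: "2 powr k * sqrt (card (S k)) \<le> sqrt (w k)" for k :: int
  proof (rule real_le_rsqrt)
    have "(2 powr k * sqrt (card (S k)))\<^sup>2 = (\<Sum>i\<in>S k. (2 powr k)\<^sup>2)"
      by (simp add: power_mult_distrib)
    also have "\<dots> \<le> w k" unfolding w_def
    proof (rule sum_mono)
      fix i assume "i \<in> S k"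
      from lev(1)[OF this] have "(2 powr k)\<^sup>2 \<le> \<bar>x i\<bar>\<^sup>2" by (intro power_mono) auto
      then show "(2 powr k)\<^sup>2 \<le> (x i)\<^sup>2" by simp
    qed
    finally show "(2 powr k * sqrt (card (S k)))\<^sup>2 \<le> w k" .
  qed
  have w0: "w k \<ge> 0" for k by (simp add: w_def sum_nonneg)
  \<comment> \<open>Dividing by \<open>2 * 2 powr k\<close> puts a level into the unit box. The two
    factors 2 and the 4 of the box lemma give 16, and the arithmetic-geometric mean inequality
    halves it.\<close>
  have near: "(\<Sum>i\<in>S k. \<Sum>j\<in>S l. M i j * x i * x j) \<le> 8 * \<beta> * (w k + w l)" for k l
  proof -
    define c where "c = \<beta> * sqrt (real (card (S k)) * real (card (S l)))"
    define u where "u i = x i / (2 * 2 powr k)" for i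
    define v where "v j = x j / (2 * 2 powr l)" for j
    have "\<bar>\<Sum>i\<in>S k. \<Sum>j\<in>S l. M i j * u i * v j\<bar> \<le> 4 * c"
    proof (rule abs_bilinear_box_le[OF finS(1) finS(1)])
      show "\<bar>u i\<bar> \<le> 1" if "i \<in> S k" for i using lev[OF that] by (simp add: u_def)
      show "\<bar>v i\<bar> \<le> 1" if "i \<in> S l" for i using lev[OF that] by (simp add: v_def)
      fix S' T' assume *: "S' \<subseteq> S k" "T' \<subseteq> S l"
      have "\<bar>\<Sum>i\<in>S'. \<Sum>j\<in>T'. M i j\<bar> \<le> \<beta> * sqrt (real (card S') * real (card T'))"
        using * finS(2) by (intro disc) blast+
      also have "\<dots> \<le> c" unfolding c_def using \<beta> * finS(1)
        by (intro mult_left_mono real_sqrt_le_mono mult_mono) (auto intro: card_mono)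
      finally show "\<bar>\<Sum>i\<in>S'. \<Sum>j\<in>T'. M i j\<bar> \<le> c" .
    qed
    moreover have "(\<Sum>i\<in>S k. \<Sum>j\<in>S l. M i j * x i * x j)
      = (4 * 2 powr k * 2 powr l) * (\<Sum>i\<in>S k. \<Sum>j\<in>S l. M i j * u i * v j)"
      by (simp add: sum_distrib_left u_def v_def field_simps)
    ultimately have "(\<Sum>i\<in>S k. \<Sum>j\<in>S l. M i j * x i * x j) \<le> (4 * 2 powr k * 2 powr l) * (4 * c)"
      by (simp add: mult_left_mono)
    also have "\<dots> = 16 * \<beta> * ((2 powr k * sqrt (card (S k))) * (2 powr l * sqrt (card (S l))))"
      by (simp add: c_def real_sqrt_mult)
    also have "\<dots> \<le> 16 * \<beta> * (sqrt (w k) * sqrt (w l))"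
      using \<beta> wge w0 by (intro mult_left_mono mult_mono) auto
    also have "\<dots> \<le> 16 * \<beta> * ((w k + w l) / 2)"
      using \<beta> w0 arith_geo_mean_sqrt[of "w k" "w l"]
      by (intro mult_left_mono) (auto simp: real_sqrt_mult)
    finally show ?thesis by simp
  qed
  \<comment> \<open>The strict inequality between the levels supplies one more power of 2, which
    absorbs the factor lost in the upper bound on \<open>x j\<close>.\<close>
  have gap: "\<bar>x i\<bar> * \<bar>x j\<bar> \<le> ((x i)\<^sup>2 + (x j)\<^sup>2) / 2 ^ R"
    if "i \<in> S k" "j \<in> S l" "l + R < k" for i j k l
  proof -
    have "\<bar>x j\<bar> \<le> 2 powr (1 + l)" using lev(2)[OF that(2)] by (simp add: powr_add)
    also have "\<dots> \<le> 2 powr (real_of_int k - real R)" using that(3) by (intro powr_mono) linarith+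
    also have "\<dots> = 2 powr k / 2 ^ R" by (simp add: powr_diff powr_realpow)
    also have "\<dots> \<le> \<bar>x i\<bar> / 2 ^ R" using lev(1)[OF that(1)] by (simp add: divide_right_mono)
    finally have "\<bar>x i\<bar> * \<bar>x j\<bar> \<le> \<bar>x i\<bar> * (\<bar>x i\<bar> / 2 ^ R)" by (intro mult_left_mono) auto
    also have "\<dots> = (x i)\<^sup>2 / 2 ^ R" by (simp add: power2_eq_square)
    also have "\<dots> \<le> ((x i)\<^sup>2 + (x j)\<^sup>2) / 2 ^ R" by (simp add: divide_right_mono)
    finally show ?thesis .
  qed
  have F0: "F i j \<ge> 0" for i j by (simp add: F_def)
  have far: "(\<Sum>i\<in>S k. \<Sum>j\<in>S l. M i j * x i * x j) \<le> (\<Sum>i\<in>S k. \<Sum>j\<in>S l. F i j)"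
    if "\<not> \<bar>k - l\<bar> \<le> int R" for k l
  proof (intro sum_mono)
    fix i j assume ij: "i \<in> S k" "j \<in> S l"
    have "\<bar>x i\<bar> * \<bar>x j\<bar> \<le> ((x i)\<^sup>2 + (x j)\<^sup>2) / 2 ^ R"
      using gap[of i k j l] gap[of j l i k] ij that by (cases "k > l") (auto simp: mult.commute add.commute)
    then have "\<bar>M i j\<bar> * (\<bar>x i\<bar> * \<bar>x j\<bar>) \<le> \<bar>M i j\<bar> * (((x i)\<^sup>2 + (x j)\<^sup>2) / 2 ^ R)"
      by (intro mult_left_mono) auto
    moreover have "M i j * x i * x j \<le> \<bar>M i j\<bar> * (\<bar>x i\<bar> * \<bar>x j\<bar>)"
      by (metis abs_ge_self abs_mult mult.assoc)
    ultimately show "M i j * x i * x j \<le> F i j" by (simp add: F_def)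
  qed
  \<comment> \<open>Each level has boundedly many near levels, so the total number of levels, which
    depends on \<open>x\<close>, does not enter the bound.\<close>
  have count: "(\<Sum>l\<in>\<Lambda>. if \<bar>k - l\<bar> \<le> int R then 1 else 0) \<le> (2 * real R + 1)" for k
  proof -
    have "(\<Sum>l\<in>\<Lambda>. if \<bar>k - l\<bar> \<le> int R then 1 else 0 :: real) = card {l \<in> \<Lambda>. \<bar>k - l\<bar> \<le> int R}"
      using fin\<Lambda> by (simp add: sum.If_cases Int_def)
    also have "card {l \<in> \<Lambda>. \<bar>k - l\<bar> \<le> int R} \<le> card {k - int R..k + int R}"
      by (intro card_mono) auto
    also have "\<dots> = 2 * R + 1" by simp
    finally show ?thesis by simp
  qed
  have wsum: "(\<Sum>k\<in>\<Lambda>. w k) = (\<Sum>i<n. (x i)\<^sup>2)"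
    unfolding w_def group by (intro sum.mono_neutral_left) (auto simp: N_def)
  have "(\<Sum>i<n. \<Sum>j<n. M i j * x i * x j) = (\<Sum>i\<in>N. \<Sum>j<n. M i j * x i * x j)"
    by (intro sum.mono_neutral_right) (auto simp: N_def)
  also have "\<dots> = (\<Sum>i\<in>N. \<Sum>j\<in>N. M i j * x i * x j)"
    by (intro sum.cong sum.mono_neutral_right) (auto simp: N_def)
  also have "\<dots> = (\<Sum>k\<in>\<Lambda>. \<Sum>l\<in>\<Lambda>. \<Sum>i\<in>S k. \<Sum>j\<in>S l. M i j * x i * x j)" by (simp add: group2)
  also have "\<dots> \<le> (\<Sum>k\<in>\<Lambda>. \<Sum>l\<in>\<Lambda>. 8 * \<beta> * (w k + w l) * (if \<bar>k - l\<bar> \<le> int R then 1 else 0)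
      + (\<Sum>i\<in>S k. \<Sum>j\<in>S l. F i j))"
  proof (intro sum_mono)
    fix k l
    show "(\<Sum>i\<in>S k. \<Sum>j\<in>S l. M i j * x i * x j) \<le> 8 * \<beta> * (w k + w l) * (if \<bar>k - l\<bar> \<le> int R then 1 else 0)
      + (\<Sum>i\<in>S k. \<Sum>j\<in>S l. F i j)"
      using near[where k = k and l = l] far[of k l] F0
      by (cases "\<bar>k - l\<bar> \<le> int R") (auto intro!: add_increasing2 sum_nonneg)
  qed
  also have "\<dots> = (\<Sum>k\<in>\<Lambda>. \<Sum>l\<in>\<Lambda>. 8 * \<beta> * w k * (if \<bar>k - l\<bar> \<le> int R then 1 else 0))
      + (\<Sum>k\<in>\<Lambda>. \<Sum>l\<in>\<Lambda>. 8 * \<beta> * w l * (if \<bar>k - l\<bar> \<le> int R then 1 else 0))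
      + (\<Sum>i\<in>N. \<Sum>j\<in>N. F i j)"
    unfolding sum.distrib group2 distrib_left distrib_right by simp
  also have "(\<Sum>k\<in>\<Lambda>. \<Sum>l\<in>\<Lambda>. 8 * \<beta> * w l * (if \<bar>k - l\<bar> \<le> int R then 1 else 0))
     = (\<Sum>k\<in>\<Lambda>. \<Sum>l\<in>\<Lambda>. 8 * \<beta> * w k * (if \<bar>k - l\<bar> \<le> int R then 1 else 0))"
    by (subst sum.swap) (simp add: abs_minus_commute)
  also have "(\<Sum>k\<in>\<Lambda>. \<Sum>l\<in>\<Lambda>. 8 * \<beta> * w k * (if \<bar>k - l\<bar> \<le> int R then 1 else 0))
     \<le> (\<Sum>k\<in>\<Lambda>. 8 * \<beta> * w k * (2 * real R + 1))"
    unfolding sum_distrib_left[symmetric] using count \<beta> w0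
    by (intro sum_mono mult_left_mono) auto
  also have "\<dots> = 8 * \<beta> * (2 * real R + 1) * (\<Sum>i<n. (x i)\<^sup>2)"
    unfolding wsum[symmetric] sum_distrib_left by (intro sum.cong refl) simp
  also have "(\<Sum>i\<in>N. \<Sum>j\<in>N. F i j) \<le> 2 * d / 2 ^ R * (\<Sum>i<n. (x i)\<^sup>2)"
  proof -
    have "(\<Sum>i\<in>N. \<Sum>j\<in>N. F i j) \<le> (\<Sum>i\<in>N. \<Sum>j<n. F i j)"
      using finN F0 by (intro sum_mono sum_mono2) auto
    also have "\<dots> \<le> (\<Sum>i<n. \<Sum>j<n. F i j)"
      using finN F0 by (intro sum_mono2) (auto intro: sum_nonneg)
    also have "\<dots> = ((\<Sum>i<n. \<Sum>j<n. \<bar>M i j\<bar> * (x i)\<^sup>2) + (\<Sum>i<n. \<Sum>j<n. \<bar>M i j\<bar> * (x j)\<^sup>2)) / 2 ^ R"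
      by (simp add: F_def sum.distrib[symmetric] sum_divide_distrib distrib_left)
    also have "(\<Sum>i<n. \<Sum>j<n. \<bar>M i j\<bar> * (x j)\<^sup>2) = (\<Sum>i<n. \<Sum>j<n. \<bar>M i j\<bar> * (x i)\<^sup>2)"
      by (subst sum.swap) (intro sum.cong refl, simp add: sym)
    also have "(\<Sum>i<n. \<Sum>j<n. \<bar>M i j\<bar> * (x i)\<^sup>2) \<le> (\<Sum>i<n. d * (x i)\<^sup>2)"
      unfolding sum_distrib_right[symmetric] using row by (intro sum_mono mult_right_mono) auto
    finally show ?thesis by (simp add: sum_distrib_left[symmetric] divide_right_mono)
  qed
  finally show ?thesis by (simp add: algebra_simps)
qed

section \<open>The dual certificate\<close>

lemma sum_clusters:
  fixes h :: "nat \<Rightarrow> real" and \<sigma> :: "nat \<Rightarrow> nat"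
  assumes "\<And>i. i < n \<Longrightarrow> \<sigma> i < r"
  shows "(\<Sum>l<r. \<Sum>j | j < n \<and> \<sigma> j = l. h j) = (\<Sum>j<n. h j)"
proof -
  have "(\<Sum>l<r. \<Sum>j | j \<in> {..<n} \<and> \<sigma> j = l. h j) = (\<Sum>j<n. h j)"
    using assms by (intro sum.group) auto
  then show ?thesis by simp
qed

text \<open>The zero diagonal reflects the absence of loops. On vectors orthogonal to the cluster
  indicators the quadratic form of this matrix is therefore \<open>- p\<close> times the squared
  norm, which only helps.\<close>

definition mean_matrix :: "real \<Rightarrow> real \<Rightarrow> (nat \<Rightarrow> nat) \<Rightarrow> nat \<Rightarrow> nat \<Rightarrow> real" where
  "mean_matrix p q \<sigma> i j = (if i = j then 0 else if \<sigma> i = \<sigma> j then p else q)"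

lemma cluster_matrix_feasible:
  assumes bal: "balanced_labelling r K \<sigma>"
  shows "sdp_feasible (r * K) K (cluster_matrix \<sigma>)"
proof -
  define n where "n = r * K"
  have \<sigma>: "\<sigma> i < r" if "i < n" for i using bal that by (auto simp: balanced_labelling_def n_def)
  have card: "card {i. i < n \<and> \<sigma> i = k} = K" if "k < r" for k
    using bal that by (auto simp: balanced_labelling_def n_def)
  have row: "(\<Sum>j<n. cluster_matrix \<sigma> i j * h j) = (\<Sum>j | j < n \<and> \<sigma> j = \<sigma> i. h j)" for i h
  proof -
    have "(\<Sum>j<n. cluster_matrix \<sigma> i j * h j) = (\<Sum>j\<in>{..<n}. if \<sigma> j = \<sigma> i then h j else 0)"
      by (rule sum.cong) (auto simp: cluster_matrix_def)
    also have "\<dots> = (\<Sum>j | j < n \<and> \<sigma> j = \<sigma> i. h j)"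
      by (subst sum.inter_filter[symmetric]) (auto intro: sum.cong)
    finally show ?thesis .
  qed
  have "0 \<le> (\<Sum>i<n. \<Sum>j<n. x i * cluster_matrix \<sigma> i j * x j)" for x
  proof -
    have "(\<Sum>i<n. \<Sum>j<n. x i * cluster_matrix \<sigma> i j * x j)
        = (\<Sum>i<n. x i * (\<Sum>j<n. cluster_matrix \<sigma> i j * x j))"
      by (simp add: sum_distrib_left mult.assoc)
    also have "\<dots> = (\<Sum>l<r. \<Sum>i | i < n \<and> \<sigma> i = l. x i * (\<Sum>j | j < n \<and> \<sigma> j = \<sigma> i. x j))"
      unfolding row by (rule sum_clusters[symmetric]) (rule \<sigma>)
    also have "\<dots> = (\<Sum>l<r. (\<Sum>i | i < n \<and> \<sigma> i = l. x i)\<^sup>2)"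
      by (simp add: power2_eq_square sum_distrib_right)
    finally show ?thesis by (simp add: sum_nonneg)
  qed
  moreover have "(\<Sum>j<n. cluster_matrix \<sigma> i j) = real K" if "i < n" for i
    using row[of i "\<lambda>_. 1"] card[OF \<sigma>[OF that]] by simp
  ultimately show ?thesis
    unfolding sdp_feasible_def psd_def n_def[symmetric] by (auto simp: cluster_matrix_def)
qed

text \<open>In the Lagrangian dual, \<open>d\<close>, \<open>lam\<close>, \<open>B\<close> and \<open>S\<close> are the multipliers of the diagonal, row sum,
  nonnegativity and positive semidefiniteness constraints.\<close>

lemma sdp_unique_opt_of_certificate:
  assumes bal: "balanced_labelling r K \<sigma>" and n: "n = r * K"
    and A: "\<And>i j. i < n \<Longrightarrow> j < n \<Longrightarrow>
      A i j = (if i = j then d i else 0) + lam i + lam j - B i j - S i j"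
    and S_sym: "\<And>i j. i < n \<Longrightarrow> j < n \<Longrightarrow> S i j = S j i"
    and S_ker: "\<And>i l. i < n \<Longrightarrow> l < r \<Longrightarrow> (\<Sum>j | j < n \<and> \<sigma> j = l. S i j) = 0"
    and S_pos: "\<And>w. (\<And>l. l < r \<Longrightarrow> (\<Sum>j | j < n \<and> \<sigma> j = l. w j) = 0) \<Longrightarrow>
      (\<Sum>i<n. \<Sum>j<n. S i j * w i * w j) \<ge> \<mu> * (\<Sum>i<n. (w i)\<^sup>2)"
    and \<mu>: "\<mu> > 0"
    and B_nonneg: "\<And>i j. i < n \<Longrightarrow> j < n \<Longrightarrow> B i j \<ge> 0"
    and B_zero: "\<And>i j. i < n \<Longrightarrow> j < n \<Longrightarrow> \<sigma> i = \<sigma> j \<Longrightarrow> B i j = 0"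
  shows "sdp_unique_opt n K A (cluster_matrix \<sigma>)"
proof -
  define Z\<^sub>0 where "Z\<^sub>0 = cluster_matrix \<sigma>"
  have \<sigma>: "\<sigma> i < r" if "i < n" for i using bal that by (auto simp: balanced_labelling_def n)
  have card: "card {i. i < n \<and> \<sigma> i = k} = K" if "k < r" for k
    using bal that by (auto simp: balanced_labelling_def n)
  have feas0: "sdp_feasible n K Z\<^sub>0" unfolding n Z\<^sub>0_def by (rule cluster_matrix_feasible[OF bal])
  \<comment> \<open>The constraints turn the \<open>d\<close> and \<open>lam\<close> parts into
    constants, so feasible points are compared only through their pairings with \<open>B\<close> and
    \<open>S\<close>, both of which vanish at \<open>Z\<^sub>0\<close> (complementary
    slackness).\<close>
  have inner: "mat_inner n A Z = (\<Sum>i<n. d i) + 2 * K * (\<Sum>i<n. lam i)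
      - (\<Sum>i<n. \<Sum>j<n. B i j * Z i j) - (\<Sum>i<n. \<Sum>j<n. S i j * Z i j)" if "sdp_feasible n K Z" for Z
  proof -
    have sym: "Z i j = Z j i" if "i < n" "j < n" for i j
      using \<open>sdp_feasible n K Z\<close> that unfolding sdp_feasible_def psd_def by blast
    have diag: "Z i i = 1" if "i < n" for i using \<open>sdp_feasible n K Z\<close> that unfolding sdp_feasible_def by blast
    have row: "(\<Sum>j<n. Z i j) = K" if "i < n" for i
      using \<open>sdp_feasible n K Z\<close> that unfolding sdp_feasible_def by blast
    have "mat_inner n A Z = (\<Sum>i<n. \<Sum>j<n. (if i = j then d i * Z i j else 0) + lam i * Z i j + lam j * Z i j
        - B i j * Z i j - S i j * Z i j)"
      unfolding mat_inner_def by (intro sum.cong refl) (auto simp: A algebra_simps)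
    also have "\<dots> = (\<Sum>i<n. \<Sum>j<n. if i = j then d i * Z i j else 0) + (\<Sum>i<n. \<Sum>j<n. lam i * Z i j)
        + (\<Sum>i<n. \<Sum>j<n. lam j * Z i j) - (\<Sum>i<n. \<Sum>j<n. B i j * Z i j) - (\<Sum>i<n. \<Sum>j<n. S i j * Z i j)"
      by (simp add: sum.distrib sum_subtractf)
    also have "(\<Sum>i<n. \<Sum>j<n. if i = j then d i * Z i j else 0) = (\<Sum>i<n. d i)"
      by (simp add: diag)
    also have "(\<Sum>i<n. \<Sum>j<n. lam i * Z i j) = (\<Sum>i<n. K * lam i)"
      by (simp add: sum_distrib_left[symmetric] row mult.commute)
    also have "(\<Sum>i<n. \<Sum>j<n. lam j * Z i j) = (\<Sum>i<n. \<Sum>j<n. lam i * Z i j)"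
      by (subst sum.swap) (intro sum.cong refl, simp add: sym)
    also have "(\<Sum>i<n. \<Sum>j<n. lam i * Z i j) = (\<Sum>i<n. K * lam i)"
      by (simp add: sum_distrib_left[symmetric] row mult.commute)
    finally show ?thesis by (simp add: sum_distrib_left[symmetric])
  qed
  have BZ0: "(\<Sum>i<n. \<Sum>j<n. B i j * Z\<^sub>0 i j) = 0"
    using B_zero by (auto simp: Z\<^sub>0_def cluster_matrix_def intro!: sum.neutral)
  have SZ0: "(\<Sum>i<n. \<Sum>j<n. S i j * Z\<^sub>0 i j) = 0"
  proof (rule sum.neutral, rule ballI)
    fix i assume "i \<in> {..<n}"
    then have i: "i < n" by simp
    have "(\<Sum>j<n. S i j * Z\<^sub>0 i j) = (\<Sum>j\<in>{..<n}. if \<sigma> j = \<sigma> i then S i j else 0)"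
      by (rule sum.cong) (auto simp: Z\<^sub>0_def cluster_matrix_def)
    also have "\<dots> = (\<Sum>j | j < n \<and> \<sigma> j = \<sigma> i. S i j)"
      by (subst sum.inter_filter[symmetric]) (auto intro: sum.cong)
    finally show "(\<Sum>j<n. S i j * Z\<^sub>0 i j) = 0" using S_ker[OF i \<sigma>[OF i]] by simp
  qed
  \<comment> \<open>The orthogonal projection onto the span of the cluster indicators, that is, the
    cluster means. \<open>S\<close> annihilates it, so only the remainder \<open>v - av v\<close>
    enters the form.\<close>
  define av where "av v i = (\<Sum>j | j < n \<and> \<sigma> j = \<sigma> i. v j) / K" for v :: "nat \<Rightarrow> real" and i
  have quad: "(\<Sum>i<n. \<Sum>j<n. S i j * v i * v j) \<ge> \<mu> * (\<Sum>i<n. (v i - av v i)\<^sup>2)" for v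
  proof -
    define w where "w i = v i - av v i" for i
    have w: "(\<Sum>j | j < n \<and> \<sigma> j = l. w j) = 0" if "l < r" for l
    proof -
      have "(\<Sum>j | j < n \<and> \<sigma> j = l. av v j) = (\<Sum>j | j < n \<and> \<sigma> j = l. (\<Sum>j | j < n \<and> \<sigma> j = l. v j) / K)"
        by (rule sum.cong) (auto simp: av_def)
      also have "\<dots> = (\<Sum>j | j < n \<and> \<sigma> j = l. v j)"
        using card[OF that] by (cases "K = 0") (auto simp: n)
      finally show ?thesis by (simp add: w_def sum_subtractf)
    qed
    have Sav: "(\<Sum>j<n. S i j * av v j) = 0" if "i < n" for i
    proof -
      have "(\<Sum>j<n. S i j * av v j) = (\<Sum>l<r. \<Sum>j | j < n \<and> \<sigma> j = l. S i j * av v j)"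
        by (rule sum_clusters[symmetric]) (rule \<sigma>)
      also have "\<dots> = (\<Sum>l<r. (\<Sum>j | j < n \<and> \<sigma> j = l. S i j) * ((\<Sum>j | j < n \<and> \<sigma> j = l. v j) / K))"
        unfolding sum_distrib_right by (intro sum.cong refl) (auto simp: av_def)
      also have "\<dots> = 0" using S_ker[OF that] by simp
      finally show ?thesis .
    qed
    have "(\<Sum>i<n. \<Sum>j<n. S i j * w i * w j) = (\<Sum>i<n. w i * ((\<Sum>j<n. S i j * v j) - (\<Sum>j<n. S i j * av v j)))"
      unfolding sum_subtractf[symmetric] sum_distrib_left
      by (intro sum.cong refl) (simp add: w_def algebra_simps)
    also have "\<dots> = (\<Sum>i<n. (v i - av v i) * (\<Sum>j<n. S i j * v j))"
      by (simp add: Sav w_def)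
    also have "\<dots> = (\<Sum>i<n. \<Sum>j<n. S i j * v i * v j) - (\<Sum>i<n. \<Sum>j<n. av v i * (S i j * v j))"
      unfolding left_diff_distrib sum_subtractf sum_distrib_left by (simp add: mult_ac)
    also have "(\<Sum>i<n. \<Sum>j<n. av v i * (S i j * v j)) = (\<Sum>j<n. v j * (\<Sum>i<n. S j i * av v i))"
      unfolding sum_distrib_left by (subst sum.swap) (intro sum.cong refl, simp add: S_sym mult_ac)
    also have "\<dots> = 0" by (simp add: Sav)
    finally show ?thesis using S_pos[OF w] by (simp add: w_def)
  qed
  show ?thesis unfolding sdp_unique_opt_def Z\<^sub>0_def[symmetric]
  proof (intro conjI allI impI feas0)
    fix Z assume "sdp_feasible n K Z \<and> (\<exists>i<n. \<exists>j<n. Z i j \<noteq> Z\<^sub>0 i j)"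
    then have feas: "sdp_feasible n K Z" and ne: "\<exists>i<n. \<exists>j<n. Z i j \<noteq> Z\<^sub>0 i j" by auto
    from feas have psd: "psd n Z" and diag: "\<And>i. i < n \<Longrightarrow> Z i i = 1"
      and nonneg: "\<And>i j. i < n \<Longrightarrow> j < n \<Longrightarrow> Z i j \<ge> 0"
      and row: "\<And>i. i < n \<Longrightarrow> (\<Sum>j<n. Z i j) = K"
      unfolding sdp_feasible_def by auto
    from psd_gram[OF psd] obtain V where V: "\<And>i j. i < n \<Longrightarrow> j < n \<Longrightarrow> Z i j = (\<Sum>k<n. V k i * V k j)"
      by blast
    have BZ: "(\<Sum>i<n. \<Sum>j<n. B i j * Z i j) \<ge> 0"
      using B_nonneg nonneg by (intro sum_nonneg) auto
    \<comment> \<open>The Gram vectors \<open>V k\<close> need not be orthogonal to the clusters;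
      \<open>quad\<close> bounds each of their forms below by the squared distance to the cluster
      means.\<close>
    have "(\<Sum>i<n. \<Sum>j<n. S i j * Z i j) = (\<Sum>i<n. \<Sum>j<n. \<Sum>k<n. S i j * V k i * V k j)"
      by (simp add: V sum_distrib_left mult_ac)
    also have "\<dots> = (\<Sum>i<n. \<Sum>k<n. \<Sum>j<n. S i j * V k i * V k j)"
      by (intro sum.cong refl sum.swap)
    also have "\<dots> = (\<Sum>k<n. \<Sum>i<n. \<Sum>j<n. S i j * V k i * V k j)" by (rule sum.swap)
    finally have "(\<Sum>i<n. \<Sum>j<n. S i j * Z i j) = (\<Sum>k<n. \<Sum>i<n. \<Sum>j<n. S i j * V k i * V k j)" .
    then have SZ: "(\<Sum>i<n. \<Sum>j<n. S i j * Z i j) \<ge> (\<Sum>k<n. \<mu> * (\<Sum>i<n. (V k i - av (V k) i)\<^sup>2))"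
      by (simp only:) (intro sum_mono quad)
    \<comment> \<open>Uniqueness: if the sum vanishes, every Gram vector is constant on clusters, so
      \<open>Z\<close> is 1 on the diagonal blocks. These already use up the row sum
      \<open>K\<close>, and nonnegativity forces zeros elsewhere.\<close>
    have "0 < (\<Sum>k<n. \<mu> * (\<Sum>i<n. (V k i - av (V k) i)\<^sup>2))"
    proof (rule ccontr)
      assume "\<not> ?thesis"
      moreover have nn: "\<mu> * (\<Sum>i<n. (V k i - av (V k) i)\<^sup>2) \<ge> 0" for k
        using \<mu> by (simp add: sum_nonneg)
      ultimately have "(\<Sum>k<n. \<mu> * (\<Sum>i<n. (V k i - av (V k) i)\<^sup>2)) = 0"
        by (meson linorder_not_le order_antisym sum_nonneg)
      then have "\<forall>k<n. \<mu> * (\<Sum>i<n. (V k i - av (V k) i)\<^sup>2) = 0"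
        using nn by (subst (asm) sum_nonneg_eq_0_iff) auto
      then have const: "V k i = av (V k) i" if "k < n" "i < n" for k i
        using that \<mu> by (auto simp: sum_nonneg_eq_0_iff)
      have one: "Z i j = 1" if "i < n" "j < n" "\<sigma> i = \<sigma> j" for i j
      proof -
        have "V k i = V k j" if "k < n" for k
          using const[OF that \<open>i < n\<close>] const[OF that \<open>j < n\<close>] \<open>\<sigma> i = \<sigma> j\<close> by (simp add: av_def)
        then have "Z i j = Z i i" using that by (simp add: V)
        then show ?thesis using diag that by simp
      qed
      have "Z i j = Z\<^sub>0 i j" if ij: "i < n" "j < n" for i j
      proof -
        have le: "Z\<^sub>0 i j \<le> Z i j" if "j < n" for j
          using one[of i j] nonneg[of i j] ij that by (auto simp: Z\<^sub>0_def cluster_matrix_def)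
        have "(\<Sum>j<n. Z i j - Z\<^sub>0 i j) = 0"
          using row[OF ij(1)] feas0 ij(1) by (simp add: sum_subtractf sdp_feasible_def)
        then have "\<forall>j<n. Z i j - Z\<^sub>0 i j = 0"
          using le by (subst (asm) sum_nonneg_eq_0_iff) auto
        then show ?thesis using ij by auto
      qed
      then show False using ne by blast
    qed
    then show "mat_inner n A Z < mat_inner n A Z\<^sub>0"
      using inner[OF feas] inner[OF feas0] BZ0 SZ0 BZ SZ by simp
  qed
qed

text \<open>The multiplier \<open>lam i\<close> is essentially the largest number of edges from \<open>i\<close> to a foreign cluster,
  divided by \<open>K\<close>. The block of \<open>B\<close> between two clusters is a row term plus a column term, determined by
  the kernel condition on \<open>S\<close>; hence the quadratic form of \<open>B\<close> vanishes on vectors orthogonal to the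
  cluster indicators, and there only \<open>d\<close> competes with the centred adjacency matrix.\<close>

lemma sdp_unique_opt_of_regularity:
  fixes A :: "nat \<Rightarrow> nat \<Rightarrow> real"
  assumes bal: "balanced_labelling r K \<sigma>" and n: "n = r * K" and r: "r \<ge> 2" and K: "K > 0"
    and p: "p \<ge> 0" and \<beta>: "\<beta> \<ge> 0"
    and A_sym: "\<And>i j. i < n \<Longrightarrow> j < n \<Longrightarrow> A i j = A j i"
    and disc: "\<And>S T. S \<subseteq> {..<n} \<Longrightarrow> T \<subseteq> {..<n} \<Longrightarrow>
      \<bar>\<Sum>i\<in>S. \<Sum>j\<in>T. A i j - mean_matrix p q \<sigma> i j\<bar> \<le> \<beta> * sqrt (real (card S) * real (card T))"
    and spec: "\<And>x. (\<Sum>i<n. \<Sum>j<n. (A i j - mean_matrix p q \<sigma> i j) * x i * x j) \<le> \<gamma> * (\<Sum>i<n. (x i)\<^sup>2)"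
    and gap: "\<And>i l. i < n \<Longrightarrow> l < r \<Longrightarrow> l \<noteq> \<sigma> i \<Longrightarrow>
      (\<Sum>j | j < n \<and> \<sigma> j = l. A i j) + g \<le> (\<Sum>j | j < n \<and> \<sigma> j = \<sigma> i. A i j)"
    and small: "\<gamma> + (r + 1) * \<beta> < g"
  shows "sdp_unique_opt n K A (cluster_matrix \<sigma>)"
proof -
  have \<sigma>: "\<sigma> i < r" if "i < n" for i using bal that by (auto simp: balanced_labelling_def n)
  define C where "C l = {j. j < n \<and> \<sigma> j = l}" for l
  have card: "card (C k) = K" if "k < r" for k
    using bal that by (auto simp: balanced_labelling_def n C_def)
  have finC: "finite (C l)" "C l \<subseteq> {..<n}" for l by (auto simp: C_def)
  define Y where "Y i l = (\<Sum>j\<in>C l. A i j)" for i l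
  define E where "E k l = (\<Sum>i\<in>C k. Y i l)" for k l
  define m where "m i = Max (Y i ` ({..<r} - {\<sigma> i}))" for i
  \<comment> \<open>Twice \<open>c\<^sub>0\<close> is the lower bound that discrepancy guarantees
    for the edge density between two clusters. Hence the constants in \<open>B\<close> cancel and
    only nonnegative terms remain.\<close>
  define c\<^sub>0 where "c\<^sub>0 = (q - \<beta> / K) / 2"
  define lam where "lam i = m i / K - c\<^sub>0" for i
  \<comment> \<open>Solves the kernel condition on the block between two clusters. The terms in
    \<open>Y\<close> from the rows and from the columns each account for all edges of the block, so
    one copy of \<open>E\<close> is added back, half in each \<open>f\<close>.\<close>
  define f where "f i l = lam i - Y i l / K + E (\<sigma> i) l / (2 * real K ^ 2)" for i l
  define B where "B i j = (if \<sigma> i = \<sigma> j then 0 else f i (\<sigma> j) + f j (\<sigma> i))" for i j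
  \<comment> \<open>Forced by the kernel condition of \<open>S\<close> on the own cluster of
    \<open>i\<close>, where \<open>B\<close> is zero.\<close>
  define d where "d i = Y i (\<sigma> i) - K * lam i - (\<Sum>j\<in>C (\<sigma> i). lam j)" for i
  define S where "S i j = (if i = j then d i else 0) - A i j - B i j + lam i + lam j" for i j
  have E_sym: "E k l = E l k" for k l
    unfolding E_def Y_def by (subst sum.swap) (intro sum.cong refl A_sym, auto simp: C_def)
  have m_ge: "Y i l \<le> m i" if "l < r" "l \<noteq> \<sigma> i" for i l
    unfolding m_def using that by (intro Max_ge) auto
  have m_in: "\<exists>l<r. l \<noteq> \<sigma> i \<and> m i = Y i l" for i
  proof -
    have "m i \<in> Y i ` ({..<r} - {\<sigma> i})" unfolding m_def
    proof (intro Max_in)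
      have "(if \<sigma> i = 0 then 1 else 0) \<in> {..<r} - {\<sigma> i}" using r by auto
      then show "Y i ` ({..<r} - {\<sigma> i}) \<noteq> {}" by blast
    qed auto
    then show ?thesis by auto
  qed
  have off: "(\<Sum>i\<in>S. Y i l - K * q) = (\<Sum>i\<in>S. \<Sum>j\<in>C l. A i j - mean_matrix p q \<sigma> i j)"
    if "S \<subseteq> C k" "k \<noteq> l" "l < r" for S k l
  proof (rule sum.cong)
    fix i assume "i \<in> S"
    then have i: "\<sigma> i = k" using that by (auto simp: C_def)
    have "(\<Sum>j\<in>C l. mean_matrix p q \<sigma> i j) = (\<Sum>j\<in>C l. q)"
      using i that by (intro sum.cong) (auto simp: C_def mean_matrix_def)
    then show "Y i l - K * q = (\<Sum>j\<in>C l. A i j - mean_matrix p q \<sigma> i j)"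
      using card[OF that(3)] by (simp add: Y_def sum_subtractf)
  qed simp
  have disc': "\<bar>\<Sum>i\<in>S. Y i l - K * q\<bar> \<le> \<beta> * K" if "S \<subseteq> C k" "k \<noteq> l" "k < r" "l < r" for S k l
  proof -
    have "\<bar>\<Sum>i\<in>S. Y i l - K * q\<bar> \<le> \<beta> * sqrt (real (card S) * real (card (C l)))"
      unfolding off[OF that(1,2,4)] using that finC by (intro disc) (auto simp: C_def)
    also have "\<dots> \<le> \<beta> * sqrt (real K * real K)"
      using that card card_mono[OF finC(1) that(1)] \<beta>
      by (intro mult_left_mono real_sqrt_le_mono mult_mono) auto
    finally show ?thesis by simp
  qed
  have E_ge: "E k l \<ge> real K ^ 2 * q - \<beta> * K" if "k \<noteq> l" "k < r" "l < r" for k l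
    using disc'[OF order.refl that] card[OF that(2)]
    by (simp add: E_def sum_subtractf power2_eq_square)
  have B_nonneg: "B i j \<ge> 0" if "i < n" "j < n" for i j
  proof (cases "\<sigma> i = \<sigma> j")
    case False
    have "B i j = (m i - Y i (\<sigma> j)) / K + (m j - Y j (\<sigma> i)) / K + (E (\<sigma> i) (\<sigma> j) / real K ^ 2 - 2 * c\<^sub>0)"
      using False E_sym[of "\<sigma> i" "\<sigma> j"] by (simp add: B_def f_def lam_def diff_divide_distrib)
    moreover have "(real K ^ 2 * q - \<beta> * K) / real K ^ 2 \<le> E (\<sigma> i) (\<sigma> j) / real K ^ 2"
      using E_ge[OF False \<sigma> \<sigma>] that by (intro divide_right_mono) auto
    moreover have "(real K ^ 2 * q - \<beta> * K) / real K ^ 2 = 2 * c\<^sub>0"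
      using K by (simp add: c\<^sub>0_def field_simps power2_eq_square)
    moreover have "(m i - Y i (\<sigma> j)) / K \<ge> 0" "(m j - Y j (\<sigma> i)) / K \<ge> 0"
      using m_ge[of "\<sigma> j" i] m_ge[of "\<sigma> i" j] False \<sigma> that by auto
    ultimately show ?thesis by linarith
  qed (simp add: B_def)
  \<comment> \<open>A maximum over foreign clusters is at most the sum of the positive parts. For a
    fixed cluster \<open>l\<close> these add up to a sum over the subset \<open>P l\<close>, which
    is a discrepancy; summing over \<open>l\<close> costs the factor \<open>r\<close>. Averaging
    over the cluster brings the error down to order \<beta>.\<close>
  have m_sum: "(\<Sum>i\<in>C k. m i) \<le> real K * (K * q + r * \<beta>)" if k: "k < r" for k
  proof -
    define P where "P l = {i \<in> C k. Y i l - K * q \<ge> 0}" for l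
    have "m i - K * q \<le> (\<Sum>l\<in>{..<r} - {k}. max 0 (Y i l - K * q))" if "i \<in> C k" for i
    proof -
      obtain l where l: "l < r" "l \<noteq> \<sigma> i" "m i = Y i l" using m_in by blast
      then have "m i - K * q \<le> max 0 (Y i l - K * q)" by simp
      also have "\<dots> \<le> (\<Sum>l\<in>{..<r} - {k}. max 0 (Y i l - K * q))"
        using l that by (intro member_le_sum) (auto simp: C_def)
      finally show ?thesis .
    qed
    then have "(\<Sum>i\<in>C k. m i - K * q) \<le> (\<Sum>i\<in>C k. \<Sum>l\<in>{..<r} - {k}. max 0 (Y i l - K * q))"
      by (rule sum_mono)
    also have "\<dots> = (\<Sum>l\<in>{..<r} - {k}. \<Sum>i\<in>C k. max 0 (Y i l - K * q))" by (rule sum.swap)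
    also have "\<dots> = (\<Sum>l\<in>{..<r} - {k}. \<Sum>i\<in>P l. Y i l - K * q)"
      unfolding P_def sum.inter_filter[OF finC(1)] by (intro sum.cong) auto
    also have "\<dots> \<le> (\<Sum>l\<in>{..<r} - {k}. \<beta> * K)"
    proof (rule sum_mono)
      fix l assume "l \<in> {..<r} - {k}"
      then have "\<bar>\<Sum>i\<in>P l. Y i l - K * q\<bar> \<le> \<beta> * K"
        using k by (intro disc'[of _ k]) (auto simp: P_def)
      then show "(\<Sum>i\<in>P l. Y i l - K * q) \<le> \<beta> * K" by linarith
    qed
    also have "\<dots> \<le> r * (\<beta> * K)" using \<beta> k by (auto intro!: mult_right_mono)
    finally show ?thesis using card[OF k] by (simp add: sum_subtractf algebra_simps)
  qed
  \<comment> \<open>The gap hypothesis gives \<open>g\<close>; the cluster average of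
    \<open>m\<close> loses \<open>r * \<beta>\<close> and the shift \<open>c\<^sub>0\<close> loses
    one more \<beta>, while the terms \<open>K * q\<close> cancel.\<close>
  have d_ge: "d i \<ge> g - (r + 1) * \<beta>" if i: "i < n" for i
  proof -
    have "d i = Y i (\<sigma> i) - m i - (\<Sum>j\<in>C (\<sigma> i). m j) / K + 2 * K * c\<^sub>0"
      using K card[OF \<sigma>[OF i]]
      by (simp add: d_def lam_def sum_subtractf sum_divide_distrib[symmetric] field_simps)
    moreover have "2 * K * c\<^sub>0 = K * q - \<beta>" using K by (simp add: c\<^sub>0_def field_simps)
    moreover have "(\<Sum>j\<in>C (\<sigma> i). m j) / K \<le> K * q + r * \<beta>"
      using m_sum[OF \<sigma>[OF i]] K by (simp add: field_simps)
    moreover have "m i + g \<le> Y i (\<sigma> i)"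
      using m_in[of i] gap[OF i] by (auto simp: Y_def C_def)
    ultimately show ?thesis by (simp add: algebra_simps)
  qed
  show ?thesis
  proof (rule sdp_unique_opt_of_certificate[OF bal n])
    show "A i j = (if i = j then d i else 0) + lam i + lam j - B i j - S i j" for i j
      by (simp add: S_def)
    show "S i j = S j i" if "i < n" "j < n" for i j
      using that A_sym by (auto simp: S_def B_def)
    show "(\<Sum>j | j < n \<and> \<sigma> j = l. S i j) = 0" if i: "i < n" and l: "l < r" for i l
    proof -
      have "(\<Sum>j\<in>C l. S i j) = (\<Sum>j\<in>C l. if i = j then d i else 0) - Y i l - (\<Sum>j\<in>C l. B i j)
          + K * lam i + (\<Sum>j\<in>C l. lam j)"
        using card[OF l] by (simp add: S_def sum.distrib sum_subtractf Y_def)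
      also have "\<dots> = 0"
      proof (cases "l = \<sigma> i")
        case True
        then have "(\<Sum>j\<in>C l. B i j) = 0" by (auto simp: B_def C_def intro!: sum.neutral)
        moreover have "(\<Sum>j\<in>C l. if i = j then d i else 0) = d i" using True i finC by (simp add: C_def)
        ultimately show ?thesis using True by (simp add: d_def)
      next
        case False
        have "(\<Sum>j\<in>C l. B i j) = (\<Sum>j\<in>C l. f i l + (lam j - Y j (\<sigma> i) / K + E l (\<sigma> i) / (2 * real K ^ 2)))"
          using False by (intro sum.cong) (auto simp: B_def C_def f_def)
        also have "\<dots> = K * f i l + (\<Sum>j\<in>C l. lam j) - E l (\<sigma> i) / K + K * (E l (\<sigma> i) / (2 * real K ^ 2))"
          using card[OF l] by (simp add: sum.distrib sum_subtractf E_def sum_divide_distrib[symmetric])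
        also have "\<dots> = K * lam i + (\<Sum>j\<in>C l. lam j) - Y i l"
          using K E_sym[of l "\<sigma> i"] by (simp add: f_def field_simps power2_eq_square)
        finally have "(\<Sum>j\<in>C l. B i j) = K * lam i + (\<Sum>j\<in>C l. lam j) - Y i l" .
        moreover have "(\<Sum>j\<in>C l. if i = j then d i else 0) = 0"
          using False by (auto simp: C_def intro!: sum.neutral)
        ultimately show ?thesis by simp
      qed
      finally show ?thesis by (simp add: C_def)
    qed
    show "g - (r + 1) * \<beta> - \<gamma> > 0" using small by simp
    show "B i j \<ge> 0" if "i < n" "j < n" for i j by (rule B_nonneg[OF that])
    show "B i j = 0" if "\<sigma> i = \<sigma> j" for i j using that by (simp add: B_def)
    fix w :: "nat \<Rightarrow> real"
    assume "\<And>l. l < r \<Longrightarrow> (\<Sum>j | j < n \<and> \<sigma> j = l. w j) = 0"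
    then have w: "\<And>l. l < r \<Longrightarrow> (\<Sum>j\<in>C l. w j) = 0" by (simp add: C_def)
    have by_cluster: "(\<Sum>j<n. h j) = (\<Sum>l<r. \<Sum>j\<in>C l. h j)" for h :: "nat \<Rightarrow> real"
      unfolding C_def by (rule sum_clusters[symmetric]) (rule \<sigma>)
    \<comment> \<open>Orthogonality to the clusters kills every matrix whose entries depend on one
      index only through its cluster. This disposes of \<open>B\<close>, of \<open>lam\<close> and
      of the mean up to its diagonal.\<close>
    have blockwise: "(\<Sum>j<n. h (\<sigma> j) * w j) = 0" for h
    proof -
      have "(\<Sum>j<n. h (\<sigma> j) * w j) = (\<Sum>l<r. h l * (\<Sum>j\<in>C l. w j))"
        unfolding by_cluster sum_distrib_left by (intro sum.cong) (auto simp: C_def)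
      then show ?thesis using w by simp
    qed
    have blockwise2: "(\<Sum>i<n. \<Sum>j<n. h i (\<sigma> j) * w i * w j) = 0" for h
    proof -
      have "(\<Sum>i<n. \<Sum>j<n. h i (\<sigma> j) * w i * w j) = (\<Sum>i<n. w i * (\<Sum>j<n. h i (\<sigma> j) * w j))"
        by (simp add: sum_distrib_left mult_ac)
      then show ?thesis by (simp add: blockwise)
    qed
    have blockwise3: "(\<Sum>i<n. \<Sum>j<n. h j (\<sigma> i) * w i * w j) = 0" for h
      using blockwise2[of h] by (subst sum.swap) (simp add: mult_ac)
    have wBw: "(\<Sum>i<n. \<Sum>j<n. B i j * w i * w j) = 0"
    proof -
      have "(\<Sum>i<n. \<Sum>j<n. B i j * w i * w j)
        = (\<Sum>i<n. \<Sum>j<n. (if \<sigma> i = \<sigma> j then 0 else f i (\<sigma> j)) * w i * w j)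
        + (\<Sum>i<n. \<Sum>j<n. (if \<sigma> j = \<sigma> i then 0 else f j (\<sigma> i)) * w i * w j)"
        unfolding sum.distrib[symmetric] by (intro sum.cong refl) (auto simp: B_def algebra_simps)
      also have "\<dots> = 0"
        using blockwise2[of "\<lambda>i l. if \<sigma> i = l then 0 else f i l"]
          blockwise3[of "\<lambda>i l. if \<sigma> i = l then 0 else f i l"] by simp
      finally show ?thesis .
    qed
    have wlw: "(\<Sum>i<n. \<Sum>j<n. lam i * w i * w j) = 0" "(\<Sum>i<n. \<Sum>j<n. lam j * w i * w j) = 0"
      using blockwise2[of "\<lambda>i _. lam i"] blockwise3[of "\<lambda>i _. lam i"] by simp_all
    have wPw: "(\<Sum>i<n. \<Sum>j<n. mean_matrix p q \<sigma> i j * w i * w j) \<le> 0"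
    proof -
      have "(\<Sum>i<n. \<Sum>j<n. mean_matrix p q \<sigma> i j * w i * w j)
        = (\<Sum>i<n. \<Sum>j<n. (if \<sigma> i = \<sigma> j then p else q) * w i * w j)
        - (\<Sum>i<n. \<Sum>j<n. if i = j then p * w i * w j else 0)"
        unfolding sum_subtractf[symmetric] by (intro sum.cong refl) (auto simp: mean_matrix_def)
      also have "\<dots> = - (\<Sum>i<n. p * w i * w i)"
        using blockwise2[of "\<lambda>i l. if \<sigma> i = l then p else q"] by simp
      also have "\<dots> \<le> 0" using p by (auto intro!: sum_nonneg simp: mult.assoc)
      finally show ?thesis .
    qed
    have "(\<Sum>i<n. \<Sum>j<n. S i j * w i * w j)
       = (\<Sum>i<n. \<Sum>j<n. if i = j then d i * w i * w j else 0)
         - (\<Sum>i<n. \<Sum>j<n. (A i j - mean_matrix p q \<sigma> i j) * w i * w j)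
         - (\<Sum>i<n. \<Sum>j<n. mean_matrix p q \<sigma> i j * w i * w j)
         - (\<Sum>i<n. \<Sum>j<n. B i j * w i * w j)
         + (\<Sum>i<n. \<Sum>j<n. lam i * w i * w j) + (\<Sum>i<n. \<Sum>j<n. lam j * w i * w j)"
      unfolding sum_subtractf[symmetric] sum.distrib[symmetric]
      by (intro sum.cong refl) (auto simp: S_def algebra_simps)
    also have "(\<Sum>i<n. \<Sum>j<n. if i = j then d i * w i * w j else 0) = (\<Sum>i<n. d i * (w i)\<^sup>2)"
      by (simp add: power2_eq_square mult.assoc)
    finally have "(\<Sum>i<n. \<Sum>j<n. S i j * w i * w j) \<ge> (\<Sum>i<n. d i * (w i)\<^sup>2) - \<gamma> * (\<Sum>i<n. (w i)\<^sup>2)"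
      using spec[of w] wPw wBw wlw by linarith
    moreover have "(\<Sum>i<n. d i * (w i)\<^sup>2) \<ge> (\<Sum>i<n. (g - (r + 1) * \<beta>) * (w i)\<^sup>2)"
      using d_ge by (intro sum_mono mult_right_mono) auto
    ultimately show "(\<Sum>i<n. \<Sum>j<n. S i j * w i * w j) \<ge> (g - (r + 1) * \<beta> - \<gamma>) * (\<Sum>i<n. (w i)\<^sup>2)"
      unfolding sum_distrib_left[symmetric] left_diff_distrib[of _ \<gamma>] by linarith
  qed
qed

section \<open>Concentration in the stochastic block model\<close>

lemma finite_vpairs [simp]: "finite (vpairs n)"
  by (rule finite_subset[of _ "{..<n} \<times> {..<n}"]) (auto simp: vpairs_def)

text \<open>The independent bits are indexed by pairs \<open>i < j\<close>, while all statistics of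
  the graph are sums over ordered pairs; this translates between the two.\<close>

lemma sum_vpairs:
  fixes g :: "nat \<Rightarrow> nat \<Rightarrow> real"
  shows "(\<Sum>i<n. \<Sum>j<n. g i j) = (\<Sum>(i, j)\<in>vpairs n. g i j + g j i) + (\<Sum>i<n. g i i)"
proof (induction n)
  case 0
  then show ?case by (simp add: vpairs_def)
next
  case (Suc n)
  have *: "vpairs (Suc n) = vpairs n \<union> (\<lambda>i. (i, n)) ` {..<n}"
    by (auto simp: vpairs_def less_Suc_eq)
  have "(\<Sum>(i, j)\<in>vpairs (Suc n). g i j + g j i)
      = (\<Sum>(i, j)\<in>vpairs n. g i j + g j i) + (\<Sum>(i, j)\<in>(\<lambda>i. (i, n)) ` {..<n}. g i j + g j i)"
    unfolding * by (rule sum.union_disjoint) (simp_all, auto simp: vpairs_def)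
  also have "(\<Sum>(i, j)\<in>(\<lambda>i. (i, n)) ` {..<n}. g i j + g j i) = (\<Sum>i<n. g i n + g n i)"
    by (subst sum.reindex) (auto simp: inj_on_def)
  finally show ?case using Suc.IH by (simp add: sum.distrib)
qed

lemma mean_matrix_sym: "mean_matrix p q \<sigma> i j = mean_matrix p q \<sigma> j i"
  by (auto simp: mean_matrix_def)

lemma sum_vpairs_mean_matrix:
  "(\<Sum>(i, j)\<in>vpairs n. mean_matrix p q \<sigma> i j * (h i j + h j i))
     = (\<Sum>i<n. \<Sum>j<n. mean_matrix p q \<sigma> i j * h i j)"
proof -
  have "(\<Sum>(i, j)\<in>vpairs n. mean_matrix p q \<sigma> i j * (h i j + h j i))
      = (\<Sum>(i, j)\<in>vpairs n. mean_matrix p q \<sigma> i j * h i j + mean_matrix p q \<sigma> j i * h j i)"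
    by (intro sum.cong refl) (auto simp: mean_matrix_sym[of p q \<sigma>] algebra_simps)
  also have "\<dots> = (\<Sum>i<n. \<Sum>j<n. mean_matrix p q \<sigma> i j * h i j)"
    unfolding sum_vpairs by (simp add: mean_matrix_def)
  finally show ?thesis .
qed

text \<open>Markov's inequality for the exponential, which factorises by independence;
  \<open>1 + x \<le> exp x\<close> then gives the Poisson form of the exponent, which is additive
  over edges.\<close>

lemma exp_functional_Pi_bernoulli_le:
  assumes "finite E" and P: "\<And>e. e \<in> E \<Longrightarrow> 0 \<le> P e \<and> P e \<le> 1"
  shows "measure_pmf.prob (Pi_pmf E False (\<lambda>e. bernoulli_pmf (P e))) {G. t \<le> (\<Sum>e\<in>E. if G e then c e else 0)}
     \<le> exp ((\<Sum>e\<in>E. P e * (exp (c e) - 1)) - t)"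
proof -
  define M where "M = Pi_pmf E False (\<lambda>e. bernoulli_pmf (P e))"
  define u where "u G = (\<Prod>e\<in>E. exp (if G e then c e else 0))" for G
  have fin: "finite (set_pmf M)"
  proof (rule finite_subset)
    show "set_pmf M \<subseteq> PiE_dflt E False (set_pmf \<circ> (\<lambda>e. bernoulli_pmf (P e)))"
      unfolding M_def by (rule set_Pi_pmf_subset'[OF assms(1)])
    show "finite (PiE_dflt E False (set_pmf \<circ> (\<lambda>e. bernoulli_pmf (P e))))"
      using assms(1) by (intro finite_PiE_dflt) auto
  qed
  have "{G. t \<le> (\<Sum>e\<in>E. if G e then c e else 0)} = {G \<in> space (measure_pmf M). exp t \<le> u G}"
    using assms(1) by (auto simp: u_def exp_sum[symmetric])
  then have "measure_pmf.prob M {G. t \<le> (\<Sum>e\<in>E. if G e then c e else 0)}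
      = measure_pmf.prob M {G \<in> space (measure_pmf M). exp t \<le> u G}" by simp
  also have "\<dots> \<le> measure_pmf.expectation M u / exp t"
    by (rule integral_Markov_inequality_measure[where A = "{}"])
      (auto simp: u_def intro!: integrable_measure_pmf_finite fin prod_nonneg)
  also have "measure_pmf.expectation M u
      = (\<Prod>e\<in>E. measure_pmf.expectation (bernoulli_pmf (P e)) (\<lambda>v. exp (if v then c e else 0)))"
    unfolding u_def M_def
    by (rule expectation_prod_Pi_pmf) (auto intro!: integrable_measure_pmf_finite assms(1))
  also have "\<dots> \<le> (\<Prod>e\<in>E. exp (P e * (exp (c e) - 1)))"
  proof (rule prod_mono)
    fix e assume e: "e \<in> E"
    have "measure_pmf.expectation (bernoulli_pmf (P e)) (\<lambda>v. exp (if v then c e else 0))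
       = 1 + P e * (exp (c e) - 1)"
      using P[OF e] by (simp add: algebra_simps)
    also have "\<dots> \<le> exp (P e * (exp (c e) - 1))" by (rule exp_ge_add_one_self)
    finally show "0 \<le> measure_pmf.expectation (bernoulli_pmf (P e)) (\<lambda>v. exp (if v then c e else 0)) \<and>
      measure_pmf.expectation (bernoulli_pmf (P e)) (\<lambda>v. exp (if v then c e else 0)) \<le> exp (P e * (exp (c e) - 1))"
      by (simp add: integral_nonneg_AE)
  qed
  also have "\<dots> = exp (\<Sum>e\<in>E. P e * (exp (c e) - 1))" using assms(1) by (simp add: exp_sum)
  finally show ?thesis by (simp add: M_def exp_diff divide_right_mono)
qed

abbreviation sbm_mean :: "nat \<Rightarrow> real \<Rightarrow> real \<Rightarrow> (nat \<Rightarrow> nat) \<Rightarrow> nat \<Rightarrow> nat \<Rightarrow> real" where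
  "sbm_mean n a b \<equiv> mean_matrix (a * ln n / n) (b * ln n / n)"

text \<open>Outside \<open>vpairs\<close> the product takes its default \<open>False\<close>. So
  almost surely there are no loops, and the disjunction in \<open>adj_matrix\<close> reads a single
  random bit for each pair.\<close>

lemma sbm_support:
  assumes "G \<in> set_pmf (sbm n a b \<sigma>)" "(i, j) \<notin> vpairs n"
  shows "\<not> G (i, j)"
  using set_Pi_pmf_subset[OF finite_vpairs, of n False] assms unfolding sbm_def by blast

text \<open>The last condition makes both edge parameters probabilities, so that
  \<open>bernoulli_pmf\<close> does not truncate them; it holds for all large
  \<open>n\<close>.\<close>

locale sbm_params =
  fixes n :: nat and a b :: real and \<sigma> :: "nat \<Rightarrow> nat"
  assumes n_pos: "n \<ge> 1" and b_pos: "0 < b" and b_le_a: "b \<le> a" and p_le_1: "a * ln n / n \<le> 1"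
begin

lemma a_pos: "0 < a"
  using b_pos b_le_a by simp

lemma ln_nonneg: "0 \<le> ln (real n)"
  using n_pos by simp

lemma q_le_p: "b * ln n / n \<le> a * ln n / n"
  using b_le_a ln_nonneg by (intro divide_right_mono mult_right_mono) auto

lemma q_nonneg: "0 \<le> b * ln n / n"
  using b_pos ln_nonneg by simp

lemma p_nonneg: "0 \<le> a * ln n / n"
  using q_nonneg q_le_p by linarith

lemma mean_nonneg: "0 \<le> sbm_mean n a b \<sigma> i j"
  using q_nonneg p_nonneg by (auto simp: mean_matrix_def)

lemma mean_le: "sbm_mean n a b \<sigma> i j \<le> a * ln n / n"
  using q_le_p p_nonneg by (auto simp: mean_matrix_def)

lemma chernoff:
  "measure_pmf.prob (sbm n a b \<sigma>) {G. t \<le> (\<Sum>i<n. \<Sum>j<n. w i j * adj_matrix G i j)}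
     \<le> exp ((\<Sum>(i, j)\<in>vpairs n. sbm_mean n a b \<sigma> i j * (exp (w i j + w j i) - 1)) - t)"
proof -
  define c where "c e = w (fst e) (snd e) + w (snd e) (fst e)" for e
  define P where "P e = sbm_mean n a b \<sigma> (fst e) (snd e)" for e
  have sbm: "sbm n a b \<sigma> = Pi_pmf (vpairs n) False (\<lambda>e. bernoulli_pmf (P e))"
    unfolding sbm_def by (rule Pi_pmf_cong) (auto simp: P_def mean_matrix_def vpairs_def)
  have "measure_pmf.prob (sbm n a b \<sigma>) {G. t \<le> (\<Sum>i<n. \<Sum>j<n. w i j * adj_matrix G i j)}
      \<le> measure_pmf.prob (sbm n a b \<sigma>) {G. t \<le> (\<Sum>e\<in>vpairs n. if G e then c e else 0)}"
  \<comment> \<open>The two sums agree only for graphs in the support, hence the almost sure form of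
    monotonicity.\<close>
  proof (rule measure_pmf.finite_measure_mono_AE)
    have "(\<Sum>i<n. \<Sum>j<n. w i j * adj_matrix G i j) = (\<Sum>e\<in>vpairs n. if G e then c e else 0)"
      if "G \<in> set_pmf (sbm n a b \<sigma>)" for G
    proof -
      have "adj_matrix G i i = 0" for i
        using sbm_support[OF that, of i i] by (simp add: adj_matrix_def vpairs_def)
      then have "(\<Sum>i<n. \<Sum>j<n. w i j * adj_matrix G i j)
          = (\<Sum>(i, j)\<in>vpairs n. w i j * adj_matrix G i j + w j i * adj_matrix G j i)"
        unfolding sum_vpairs by simp
      also have "\<dots> = (\<Sum>e\<in>vpairs n. if G e then c e else 0)"
      proof (intro sum.cong refl, clarify)
        fix i j assume "(i, j) \<in> vpairs n"
        then have "(j, i) \<notin> vpairs n" by (auto simp: vpairs_def)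
        from sbm_support[OF \<open>G \<in> set_pmf (sbm n a b \<sigma>)\<close> this]
        show "w i j * adj_matrix G i j + w j i * adj_matrix G j i = (if G (i, j) then c (i, j) else 0)"
          by (auto simp: adj_matrix_def c_def)
      qed
      finally show ?thesis .
    qed
    then show "AE G in measure_pmf (sbm n a b \<sigma>).
        G \<in> {G. t \<le> (\<Sum>i<n. \<Sum>j<n. w i j * adj_matrix G i j)} \<longrightarrow>
        G \<in> {G. t \<le> (\<Sum>e\<in>vpairs n. if G e then c e else 0)}"
      by (auto simp: AE_measure_pmf_iff)
  qed simp
  also have "\<dots> \<le> exp ((\<Sum>e\<in>vpairs n. P e * (exp (c e) - 1)) - t)"
    unfolding sbm using mean_nonneg order.trans[OF mean_le p_le_1]
    by (intro exp_functional_Pi_bernoulli_le) (auto simp: P_def)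
  finally show ?thesis by (simp add: P_def c_def case_prod_unfold)
qed

text \<open>Tilt 1 multiplies the expected degree, at most \<open>a * ln n\<close>, by
  \<open>exp 1 - 1 \<le> 2\<close>. For \<open>i < j\<close> the symmetrised weight is 0 or 1, so
  the exponent is linear in it.\<close>

lemma degree_tail:
  assumes v: "v < n"
  shows "measure_pmf.prob (sbm n a b \<sigma>) {G. C * ln n \<le> (\<Sum>j<n. adj_matrix G v j)} \<le> exp ((2 * a - C) * ln n)"
proof -
  define w :: "nat \<Rightarrow> nat \<Rightarrow> real" where "w i j = (if i = v then 1 else 0)" for i j
  have row: "(\<Sum>i<n. \<Sum>j<n. h i j * w i j) = (\<Sum>j<n. h v j)" for h
  proof -
    have "(\<Sum>i<n. \<Sum>j<n. h i j * w i j) = (\<Sum>i<n. if i = v then \<Sum>j<n. h i j else 0)"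
      by (intro sum.cong) (auto simp: w_def)
    then show ?thesis using v by simp
  qed
  have e: "exp 1 - 1 \<le> (2 :: real)" using exp_le by linarith
  have "(\<Sum>(i, j)\<in>vpairs n. sbm_mean n a b \<sigma> i j * (exp (w i j + w j i) - 1))
      = (exp 1 - 1) * (\<Sum>(i, j)\<in>vpairs n. sbm_mean n a b \<sigma> i j * (w i j + w j i))"
    unfolding sum_distrib_left by (intro sum.cong refl) (auto simp: w_def vpairs_def)
  also have "\<dots> = (exp 1 - 1) * (\<Sum>j<n. sbm_mean n a b \<sigma> v j)"
    unfolding sum_vpairs_mean_matrix row ..
  also have "\<dots> \<le> 2 * (\<Sum>j<n. a * ln n / n)"
    using e mean_nonneg mean_le by (intro mult_mono sum_mono sum_nonneg) auto
  also have "\<dots> = 2 * a * ln n" using n_pos by simp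
  finally have "(\<Sum>(i, j)\<in>vpairs n. sbm_mean n a b \<sigma> i j * (exp (w i j + w j i) - 1)) - C * ln n
     \<le> (2 * a - C) * ln n" by (simp add: algebra_simps)
  moreover have "(\<Sum>i<n. \<Sum>j<n. w i j * adj_matrix G i j) = (\<Sum>j<n. adj_matrix G v j)" for G
    using row[of "adj_matrix G"] by (simp add: mult.commute)
  ultimately show ?thesis
    using chernoff[of "C * ln n" w] by (simp add: order.trans[OF _ exp_le_cancel_iff[THEN iffD2]])
qed

text \<open>Edges to cluster \<open>l\<close> get weight \<theta>, edges to the own cluster
  \<open>- \<theta>\<close>. This \<theta> minimises
  \<open>b * exp \<theta> + a * exp (- \<theta>)\<close>, with minimum
  \<open>2 * sqrt (a * b)\<close>; the density \<open>K / n = 1 / r\<close> accounts for the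
  division by \<open>r\<close>, and the margin costs \<open>\<theta> * g\<close>.\<close>

lemma gap_tail:
  assumes bal: "balanced_labelling r K \<sigma>" and n: "n = r * K"
    and v: "v < n" and l: "l < r" "l \<noteq> \<sigma> v"
    and ba: "b < a" and \<theta>: "\<theta> = ln (a / b) / 2"
  shows "measure_pmf.prob (sbm n a b \<sigma>)
     {G. \<not> (\<Sum>j | j < n \<and> \<sigma> j = l. adj_matrix G v j) + g \<le> (\<Sum>j | j < n \<and> \<sigma> j = \<sigma> v. adj_matrix G v j)}
     \<le> exp (1 + \<theta> * g - (sqrt a - sqrt b)\<^sup>2 / r * ln n)"
proof -
  define L where "L = ln (real n)"
  define C where "C l = {j. j < n \<and> \<sigma> j = l}" for l
  have \<sigma>: "\<sigma> v < r" using bal v by (auto simp: balanced_labelling_def n)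
  have card: "card (C k) = K" if "k < r" for k
    using bal that by (auto simp: balanced_labelling_def n C_def)
  have finC: "finite (C k)" "C k \<subseteq> {..<n}" for k by (auto simp: C_def)
  have K: "K > 0" and r: "r > 0" using v n by (auto intro: gr0I)
  have \<theta>0: "\<theta> > 0" using ba b_pos by (simp add: \<theta>)
  define s where "s j = (if \<sigma> j = l then \<theta> else if \<sigma> j = \<sigma> v then - \<theta> else 0)" for j
  define w where "w i j = (if i = v then s j else 0)" for i j
  define h where "h i j = (if i = v then exp (s j) - 1 else 0)" for i j
  have expand: "(\<Sum>j<n. f j * t (\<sigma> j)) = (\<Sum>j\<in>C l. f j * t l) + (\<Sum>j\<in>C (\<sigma> v). f j * t (\<sigma> v))"
    if t: "\<And>k. k \<noteq> l \<Longrightarrow> k \<noteq> \<sigma> v \<Longrightarrow> t k = 0" for f t :: "nat \<Rightarrow> real"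
  proof -
    have "(\<Sum>j<n. f j * t (\<sigma> j)) = (\<Sum>j\<in>C l \<union> C (\<sigma> v). f j * t (\<sigma> j))"
      using t by (intro sum.mono_neutral_right) (auto simp: C_def)
    also have "\<dots> = (\<Sum>j\<in>C l. f j * t (\<sigma> j)) + (\<Sum>j\<in>C (\<sigma> v). f j * t (\<sigma> j))"
      using l by (intro sum.union_disjoint) (auto simp: C_def)
    also have "\<dots> = (\<Sum>j\<in>C l. f j * t l) + (\<Sum>j\<in>C (\<sigma> v). f j * t (\<sigma> v))"
      by (intro arg_cong2[of _ _ _ _ "(+)"] sum.cong) (auto simp: C_def)
    finally show ?thesis .
  qed
  have row: "(\<Sum>i<n. \<Sum>j<n. if i = v then f i j else 0) = (\<Sum>j<n. f v j)" for f :: "nat \<Rightarrow> nat \<Rightarrow> real"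
  proof -
    have "(\<Sum>i<n. \<Sum>j<n. if i = v then f i j else 0) = (\<Sum>i<n. if i = v then \<Sum>j<n. f i j else 0)"
      by (intro sum.cong) auto
    then show ?thesis using v by simp
  qed
  have wA: "(\<Sum>i<n. \<Sum>j<n. w i j * adj_matrix G i j)
      = \<theta> * (\<Sum>j\<in>C l. adj_matrix G v j) - \<theta> * (\<Sum>j\<in>C (\<sigma> v). adj_matrix G v j)" for G
  proof -
    have "(\<Sum>i<n. \<Sum>j<n. w i j * adj_matrix G i j) = (\<Sum>i<n. \<Sum>j<n. if i = v then adj_matrix G i j * s j else 0)"
      by (intro sum.cong) (auto simp: w_def)
    also have "\<dots> = (\<Sum>j<n. adj_matrix G v j * s j)" by (rule row)
    also have "\<dots> = \<theta> * (\<Sum>j\<in>C l. adj_matrix G v j) - \<theta> * (\<Sum>j\<in>C (\<sigma> v). adj_matrix G v j)"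
      unfolding s_def using l(2)
      by (subst expand[where t = "\<lambda>k. if k = l then \<theta> else if k = \<sigma> v then - \<theta> else 0"])
        (auto simp: sum_distrib_left sum_negf mult.commute)
    finally show ?thesis .
  qed
  have e\<theta>: "exp \<theta> = sqrt a / sqrt b" "exp (- \<theta>) = sqrt b / sqrt a"
  proof -
    have "exp \<theta> = exp (ln (a / b)) powr (1 / 2)"
      unfolding \<theta> powr_def by simp
    also have "\<dots> = sqrt (a / b)" using a_pos b_pos by (simp add: powr_half_sqrt)
    finally show "exp \<theta> = sqrt a / sqrt b" by (simp add: real_sqrt_divide)
    then show "exp (- \<theta>) = sqrt b / sqrt a" by (simp add: exp_minus)
  qed
  have "(\<Sum>(i, j)\<in>vpairs n. sbm_mean n a b \<sigma> i j * (exp (w i j + w j i) - 1))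
      = (\<Sum>(i, j)\<in>vpairs n. sbm_mean n a b \<sigma> i j * (h i j + h j i))"
    by (intro sum.cong refl) (auto simp: w_def h_def vpairs_def)
  also have "\<dots> = (\<Sum>i<n. \<Sum>j<n. if i = v then sbm_mean n a b \<sigma> i j * (exp (s j) - 1) else 0)"
    unfolding sum_vpairs_mean_matrix by (intro sum.cong) (auto simp: h_def)
  also have "\<dots> = (\<Sum>j<n. sbm_mean n a b \<sigma> v j * (exp (s j) - 1))" by (rule row)
  also have "\<dots> = (\<Sum>j\<in>C l. sbm_mean n a b \<sigma> v j * (exp \<theta> - 1))
      + (\<Sum>j\<in>C (\<sigma> v). sbm_mean n a b \<sigma> v j * (exp (- \<theta>) - 1))"
    unfolding s_def using l(2)
    by (subst expand[where t = "\<lambda>k. exp (if k = l then \<theta> else if k = \<sigma> v then - \<theta> else 0) - 1"]) auto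
  also have "(\<Sum>j\<in>C l. sbm_mean n a b \<sigma> v j * (exp \<theta> - 1)) = (\<Sum>j\<in>C l. b * L / n * (exp \<theta> - 1))"
    using l by (intro sum.cong) (auto simp: C_def mean_matrix_def L_def)
  also have "\<dots> = K * (b * L / n * (exp \<theta> - 1))" using card[OF l(1)] by simp
  \<comment> \<open>The vertex \<open>v\<close> has no loop, so its own cluster contributes only
    \<open>K - 1\<close> edges. The correction is at most 1 and is the source of the 1 in the
    exponent.\<close>
  also have "(\<Sum>j\<in>C (\<sigma> v). sbm_mean n a b \<sigma> v j * (exp (- \<theta>) - 1))
      = (\<Sum>j\<in>C (\<sigma> v). a * L / n * (exp (- \<theta>) - 1)) - (\<Sum>j\<in>C (\<sigma> v). if j = v then a * L / n * (exp (- \<theta>) - 1) else 0)"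
    unfolding sum_subtractf[symmetric] by (intro sum.cong) (auto simp: C_def mean_matrix_def L_def)
  also have "\<dots> = K * (a * L / n * (exp (- \<theta>) - 1)) + a * L / n * (1 - exp (- \<theta>))"
    using card[OF \<sigma>] v finC by (simp add: C_def algebra_simps diff_divide_distrib)
  also have "a * L / n * (1 - exp (- \<theta>)) \<le> 1 * 1"
    using p_le_1 p_nonneg \<theta>0 by (intro mult_mono) (auto simp: L_def)
  also have "K * (b * L / n * (exp \<theta> - 1)) + (K * (a * L / n * (exp (- \<theta>) - 1)) + 1 * 1)
     = 1 - (sqrt a - sqrt b)\<^sup>2 / r * L"
  proof -
    have "real K / n = 1 / r" using K r by (simp add: n)
    moreover have "K * (b * L / n * (exp \<theta> - 1)) + K * (a * L / n * (exp (- \<theta>) - 1))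
      = (real K / n) * (L * (b * (exp \<theta> - 1) + a * (exp (- \<theta>) - 1)))"
      by (simp add: distrib_left mult_ac)
    ultimately have "K * (b * L / n * (exp \<theta> - 1)) + K * (a * L / n * (exp (- \<theta>) - 1))
      = (L / r) * (b * (exp \<theta> - 1) + a * (exp (- \<theta>) - 1))"
      by (simp only:) simp
    also have "b * (exp \<theta> - 1) + a * (exp (- \<theta>) - 1) = - (sqrt a - sqrt b)\<^sup>2"
    proof -
      have "b = sqrt b * sqrt b" "a = sqrt a * sqrt a" using a_pos b_pos by auto
      moreover have "sqrt b \<noteq> 0" "sqrt a \<noteq> 0" using a_pos b_pos by auto
      ultimately have "b * (sqrt a / sqrt b) = sqrt a * sqrt b" "a * (sqrt b / sqrt a) = sqrt a * sqrt b"
        by (metis (no_types, opaque_lifting) mult.commute mult.left_commute nonzero_mult_div_cancel_left times_divide_eq_right)+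
      then show ?thesis unfolding e\<theta> using a_pos b_pos
        by (simp add: right_diff_distrib power2_diff)
    qed
    finally show ?thesis by simp
  qed
  finally have bound: "(\<Sum>(i, j)\<in>vpairs n. sbm_mean n a b \<sigma> i j * (exp (w i j + w j i) - 1)) - (- \<theta> * g)
     \<le> 1 + \<theta> * g - (sqrt a - sqrt b)\<^sup>2 / r * L" by simp
  have "measure_pmf.prob (sbm n a b \<sigma>)
     {G. \<not> (\<Sum>j\<in>C l. adj_matrix G v j) + g \<le> (\<Sum>j\<in>C (\<sigma> v). adj_matrix G v j)}
     \<le> measure_pmf.prob (sbm n a b \<sigma>) {G. - \<theta> * g \<le> (\<Sum>i<n. \<Sum>j<n. w i j * adj_matrix G i j)}"
  proof (rule measure_pmf.finite_measure_mono, clarify)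
    fix G assume "\<not> (\<Sum>j\<in>C l. adj_matrix G v j) + g \<le> (\<Sum>j\<in>C (\<sigma> v). adj_matrix G v j)"
    then have "\<theta> * (\<Sum>j\<in>C (\<sigma> v). adj_matrix G v j) \<le> \<theta> * ((\<Sum>j\<in>C l. adj_matrix G v j) + g)"
      using \<theta>0 by (intro mult_left_mono) auto
    then show "- \<theta> * g \<le> (\<Sum>i<n. \<Sum>j<n. w i j * adj_matrix G i j)"
      unfolding wA by (simp add: algebra_simps)
  qed simp
  also note chernoff
  also have "exp ((\<Sum>(i, j)\<in>vpairs n. sbm_mean n a b \<sigma> i j * (exp (w i j + w j i) - 1)) - (- \<theta> * g))
     \<le> exp (1 + \<theta> * g - (sqrt a - sqrt b)\<^sup>2 / r * L)" using bound by simp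
  finally show ?thesis by (simp add: C_def L_def)
qed

end

section \<open>Discrepancy tails and the union bound over pairs of vertex sets\<close>

lemma exp_minus_linear_le:
  fixes x :: real
  shows "exp x - 1 - x \<le> x\<^sup>2 / 2 * exp \<bar>x\<bar>"
proof -
  obtain t where t: "\<bar>t\<bar> \<le> \<bar>x\<bar>" "exp x = (\<Sum>m<2. x ^ m / fact m) + exp t / fact 2 * x ^ 2"
    using Maclaurin_exp_le[of x 2] by blast
  have "exp t \<le> exp \<bar>x\<bar>" using t(1) by simp
  then have "exp t * x\<^sup>2 \<le> exp \<bar>x\<bar> * x\<^sup>2" by (intro mult_right_mono) auto
  then show ?thesis using t(2) by (simp add: numeral_2_eq_2 mult_ac)
qed

text \<open>With \<open>x = 1 / n\<close> the right side stays below e, so weights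
  \<open>(1 / n) ^ card S\<close> make a union bound over all vertex sets affordable.\<close>

lemma sum_Pow_power_card:
  fixes x :: real
  assumes "finite A"
  shows "(\<Sum>S\<in>Pow A. x ^ card S) = (1 + x) ^ card A"
  using prod_add[OF assms, of "\<lambda>_. x" "\<lambda>_. 1"] by (simp add: add.commute)

context sbm_params
begin

text \<open>Expanding the exponential to second order, the linear term cancels the mean and the
  quadratic one acts as variance. Since \<open>S\<close> and \<open>T\<close> may overlap, an
  unordered pair can count twice, hence \<open>exp (2 * \<theta>)\<close>. The sign \<open>z\<close>
  selects the upper or the lower tail.\<close>

lemma discrepancy_tail_signed:
  assumes S: "S \<subseteq> {..<n}" and T: "T \<subseteq> {..<n}" and \<theta>: "\<theta> \<ge> 0" and z: "\<bar>z\<bar> = 1"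
  shows "measure_pmf.prob (sbm n a b \<sigma>)
      {G. u \<le> z * (\<Sum>i\<in>S. \<Sum>j\<in>T. adj_matrix G i j - sbm_mean n a b \<sigma> i j)}
    \<le> exp (\<theta>\<^sup>2 * exp (2 * \<theta>) * (a * ln n / n) * (card S * card T) - \<theta> * u)"
proof -
  define P where "P = sbm_mean n a b \<sigma>"
  define k :: "nat \<Rightarrow> nat \<Rightarrow> real" where "k i j = (if i \<in> S \<and> j \<in> T then 1 else 0)" for i j
  define w where "w i j = z * \<theta> * k i j" for i j
  have restrict: "(\<Sum>i<n. \<Sum>j<n. h i j * k i j) = (\<Sum>i\<in>S. \<Sum>j\<in>T. h i j)" for h
  proof -
    have "(\<Sum>i<n. \<Sum>j<n. h i j * k i j) = (\<Sum>i\<in>S. \<Sum>j<n. h i j * k i j)"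
      using S by (intro sum.mono_neutral_right) (auto simp: k_def)
    also have "\<dots> = (\<Sum>i\<in>S. \<Sum>j\<in>T. h i j)"
      using T by (intro sum.cong refl sum.mono_neutral_cong_right) (auto simp: k_def)
    finally show ?thesis .
  qed
  have wh: "(\<Sum>i<n. \<Sum>j<n. w i j * h i j) = \<theta> * (z * (\<Sum>i\<in>S. \<Sum>j\<in>T. h i j))" for h
    unfolding restrict[symmetric] sum_distrib_left by (intro sum.cong) (auto simp: w_def)
  have pt: "exp (w i j + w j i) - 1 \<le> (w i j + w j i) + \<theta>\<^sup>2 * exp (2 * \<theta>) * (k i j + k j i)" for i j
  proof -
    define c where "c = w i j + w j i"
    define \<kappa> where "\<kappa> = k i j + k j i"
    have \<kappa>: "0 \<le> \<kappa>" "\<kappa> \<le> 2" by (auto simp: \<kappa>_def k_def)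
    have "c = z * (\<theta> * \<kappa>)" by (simp add: c_def \<kappa>_def w_def algebra_simps)
    then have c: "\<bar>c\<bar> = \<theta> * \<kappa>" using z \<theta> \<kappa> by (simp add: abs_mult)
    have "exp c - 1 - c \<le> c\<^sup>2 / 2 * exp \<bar>c\<bar>" by (rule exp_minus_linear_le)
    also have "c\<^sup>2 = \<theta>\<^sup>2 * \<kappa>\<^sup>2" using c by (metis power2_abs power_mult_distrib)
    also have "\<theta>\<^sup>2 * \<kappa>\<^sup>2 / 2 * exp \<bar>c\<bar> \<le> \<theta>\<^sup>2 * \<kappa> * exp (2 * \<theta>)"
    proof (intro mult_mono)
      have "\<kappa> * \<kappa> \<le> 2 * \<kappa>" using \<kappa> by (intro mult_right_mono)
      then have "\<kappa>\<^sup>2 / 2 \<le> \<kappa>" by (simp add: power2_eq_square)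
      then have "\<theta>\<^sup>2 * (\<kappa>\<^sup>2 / 2) \<le> \<theta>\<^sup>2 * \<kappa>" by (intro mult_left_mono) auto
      then show "\<theta>\<^sup>2 * \<kappa>\<^sup>2 / 2 \<le> \<theta>\<^sup>2 * \<kappa>" by simp
      show "exp \<bar>c\<bar> \<le> exp (2 * \<theta>)" unfolding c using \<kappa> \<theta> mult_left_mono[of \<kappa> 2 \<theta>] by simp
    qed (use \<kappa> in auto)
    finally show ?thesis by (simp add: c_def \<kappa>_def algebra_simps)
  qed
  have "(\<Sum>(i, j)\<in>vpairs n. P i j * (exp (w i j + w j i) - 1))
     \<le> (\<Sum>(i, j)\<in>vpairs n. P i j * (w i j + w j i) + \<theta>\<^sup>2 * exp (2 * \<theta>) * (P i j * (k i j + k j i)))"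
  proof (intro sum_mono, clarify)
    fix i j
    have "P i j * (exp (w i j + w j i) - 1) \<le> P i j * ((w i j + w j i) + \<theta>\<^sup>2 * exp (2 * \<theta>) * (k i j + k j i))"
      unfolding P_def using mean_nonneg pt by (intro mult_left_mono) auto
    then show "P i j * (exp (w i j + w j i) - 1)
        \<le> P i j * (w i j + w j i) + \<theta>\<^sup>2 * exp (2 * \<theta>) * (P i j * (k i j + k j i))"
      by (simp add: algebra_simps)
  qed
  also have "\<dots> = (\<Sum>(i, j)\<in>vpairs n. P i j * (w i j + w j i))
      + \<theta>\<^sup>2 * exp (2 * \<theta>) * (\<Sum>(i, j)\<in>vpairs n. P i j * (k i j + k j i))"
    by (simp add: case_prod_unfold sum.distrib sum_distrib_left)
  also have "\<dots> = \<theta> * (z * (\<Sum>i\<in>S. \<Sum>j\<in>T. P i j)) + \<theta>\<^sup>2 * exp (2 * \<theta>) * (\<Sum>i\<in>S. \<Sum>j\<in>T. P i j)"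
    unfolding P_def sum_vpairs_mean_matrix restrict by (simp add: wh[symmetric] mult.commute)
  also have "\<dots> \<le> \<theta> * (z * (\<Sum>i\<in>S. \<Sum>j\<in>T. P i j)) + \<theta>\<^sup>2 * exp (2 * \<theta>) * (\<Sum>i\<in>S. \<Sum>j\<in>T. a * ln n / n)"
    unfolding P_def using mean_le by (intro add_left_mono mult_left_mono sum_mono) auto
  finally have bound: "(\<Sum>(i, j)\<in>vpairs n. P i j * (exp (w i j + w j i) - 1))
      - (\<theta> * u + \<theta> * (z * (\<Sum>i\<in>S. \<Sum>j\<in>T. P i j)))
      \<le> \<theta>\<^sup>2 * exp (2 * \<theta>) * (a * ln n / n) * (card S * card T) - \<theta> * u"
    by (simp add: mult_ac)
  have "measure_pmf.prob (sbm n a b \<sigma>) {G. u \<le> z * (\<Sum>i\<in>S. \<Sum>j\<in>T. adj_matrix G i j - P i j)}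
    \<le> measure_pmf.prob (sbm n a b \<sigma>) {G. \<theta> * u + \<theta> * (z * (\<Sum>i\<in>S. \<Sum>j\<in>T. P i j))
         \<le> (\<Sum>i<n. \<Sum>j<n. w i j * adj_matrix G i j)}"
  proof (rule measure_pmf.finite_measure_mono, clarify)
    fix G assume "u \<le> z * (\<Sum>i\<in>S. \<Sum>j\<in>T. adj_matrix G i j - P i j)"
    then have "\<theta> * u \<le> \<theta> * (z * (\<Sum>i\<in>S. \<Sum>j\<in>T. adj_matrix G i j - P i j))"
      using \<theta> by (intro mult_left_mono)
    then show "\<theta> * u + \<theta> * (z * (\<Sum>i\<in>S. \<Sum>j\<in>T. P i j)) \<le> (\<Sum>i<n. \<Sum>j<n. w i j * adj_matrix G i j)"
      unfolding wh sum_subtractf by (simp add: algebra_simps)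
  qed simp
  also note chernoff[folded P_def]
  also note exp_le_cancel_iff[THEN iffD2, OF bound]
  finally show ?thesis by (simp add: P_def)
qed

text \<open>The variance term is proportional to \<open>x\<^sup>2 / n\<close>, hence at most
  \<open>\<kappa> * x\<close> up to the common factors. The condition \<open>small\<close> lets it
  consume half of the linear gain: small sets tolerate a large tilt.\<close>

lemma discrepancy_tail:
  fixes x \<alpha> \<kappa> :: real
  assumes S: "S \<subseteq> {..<n}" and T: "T \<subseteq> {..<n}" and \<theta>: "\<theta> \<ge> 0"
    and x: "x = sqrt (real (card S) * real (card T))" "x \<le> \<kappa> * n"
    and small: "\<theta> * exp (2 * \<theta>) * a * \<kappa> \<le> \<alpha> / 2"
  shows "measure_pmf.prob (sbm n a b \<sigma>)
      {G. \<bar>\<Sum>i\<in>S. \<Sum>j\<in>T. adj_matrix G i j - sbm_mean n a b \<sigma> i j\<bar> > \<alpha> * ln n * x}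
    \<le> 2 * exp (- (\<theta> * \<alpha> / 2) * ln n * x)"
proof -
  define D where "D G = (\<Sum>i\<in>S. \<Sum>j\<in>T. adj_matrix G i j - sbm_mean n a b \<sigma> i j)" for G
  have x0: "x \<ge> 0" by (simp add: x)
  have "\<theta>\<^sup>2 * exp (2 * \<theta>) * (a * ln n / n) * (card S * card T)
      = \<theta> * (\<theta> * exp (2 * \<theta>) * a) * (ln n * x) * (x / n)"
    by (simp add: x power2_eq_square mult_ac)
  also have "\<dots> \<le> \<theta> * (\<theta> * exp (2 * \<theta>) * a) * (ln n * x) * \<kappa>"
    using x(2) n_pos \<theta> a_pos ln_nonneg x0 by (intro mult_left_mono) (auto simp: field_simps)
  also have "\<dots> = \<theta> * (ln n * x) * (\<theta> * exp (2 * \<theta>) * a * \<kappa>)" by simp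
  also have "\<dots> \<le> \<theta> * (ln n * x) * (\<alpha> / 2)"
    using small \<theta> ln_nonneg x0 by (intro mult_left_mono) auto
  finally have e: "\<theta>\<^sup>2 * exp (2 * \<theta>) * (a * ln n / n) * (card S * card T) - \<theta> * (\<alpha> * ln n * x)
      \<le> - (\<theta> * \<alpha> / 2) * ln n * x" by (simp add: algebra_simps)
  have half: "measure_pmf.prob (sbm n a b \<sigma>) {G. \<alpha> * ln n * x \<le> z * D G} \<le> exp (- (\<theta> * \<alpha> / 2) * ln n * x)"
    if "\<bar>z\<bar> = 1" for z
    using discrepancy_tail_signed[OF S T \<theta> that, of "\<alpha> * ln n * x"] exp_le_cancel_iff[THEN iffD2, OF e]
    unfolding D_def by linarith
  have "measure_pmf.prob (sbm n a b \<sigma>) {G. \<bar>D G\<bar> > \<alpha> * ln n * x}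
    \<le> measure_pmf.prob (sbm n a b \<sigma>) ({G. \<alpha> * ln n * x \<le> 1 * D G} \<union> {G. \<alpha> * ln n * x \<le> (- 1) * D G})"
    by (intro measure_pmf.finite_measure_mono) auto
  also have "\<dots> \<le> measure_pmf.prob (sbm n a b \<sigma>) {G. \<alpha> * ln n * x \<le> 1 * D G}
      + measure_pmf.prob (sbm n a b \<sigma>) {G. \<alpha> * ln n * x \<le> (- 1) * D G}"
    by (intro measure_Un_le) auto
  finally show ?thesis using half[of 1] half[of "- 1"] by (simp add: D_def)
qed

end

text \<open>For pairs of small sets a large exponential tilt beats the entropy \<open>n\<close> to the power \<open>|S| + |T|\<close>;
  for pairs of linear size any fixed tilt gives \<open>exp (- c n log n)\<close>, which beats the \<open>4 ^ n\<close> pairs.\<close>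

lemma sbm_discrepancy_comparable:
  fixes a b \<alpha> \<epsilon> :: real
  assumes ab: "0 < b" "b \<le> a" and \<alpha>: "\<alpha> > 0" and \<epsilon>: "\<epsilon> > 0"
  shows "\<forall>\<^sub>F n in sequentially. \<forall>\<sigma>. measure_pmf.prob (sbm n a b \<sigma>)
      {G. \<exists>S T. S \<subseteq> {..<n} \<and> T \<subseteq> {..<n} \<and> card S \<le> card T \<and> \<epsilon>\<^sup>2 * card T \<le> card S \<and>
         \<bar>\<Sum>i\<in>S. \<Sum>j\<in>T. adj_matrix G i j - sbm_mean n a b \<sigma> i j\<bar> > \<alpha> * ln n * sqrt (real (card S) * real (card T))}
      \<le> 20 / n"
proof -
  have a: "a > 0" using ab by simp
  \<comment> \<open>\<open>\<theta>\<^sub>1\<close> makes the exponent at least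
    \<open>3 * t * ln n\<close>, enough for the entropy \<open>s + t\<close> and a spare factor
    \<open>1 / n\<close>; \<kappa> is the largest size ratio admitting this tilt.
    \<open>\<theta>\<^sub>2\<close> is admissible at every size, the cap 1 serving to bound
    \<open>exp (2 * \<theta>\<^sub>2)\<close> by \<open>exp 2\<close>.\<close>
  define \<theta>\<^sub>1 where "\<theta>\<^sub>1 = 6 / (\<alpha> * \<epsilon>)"
  define \<kappa> where "\<kappa> = \<alpha> / (2 * \<theta>\<^sub>1 * exp (2 * \<theta>\<^sub>1) * a)"
  define \<theta>\<^sub>2 where "\<theta>\<^sub>2 = min 1 (\<alpha> / (2 * exp 2 * a))"
  have \<theta>\<^sub>1: "\<theta>\<^sub>1 > 0" using \<alpha> \<epsilon> by (simp add: \<theta>\<^sub>1_def)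
  have \<kappa>: "\<kappa> > 0" "\<theta>\<^sub>1 * exp (2 * \<theta>\<^sub>1) * a * \<kappa> \<le> \<alpha> / 2" using \<theta>\<^sub>1 \<alpha> a by (auto simp: \<kappa>_def)
  have \<theta>\<^sub>2: "\<theta>\<^sub>2 > 0" "\<theta>\<^sub>2 \<le> 1" "\<theta>\<^sub>2 \<le> \<alpha> / (2 * exp 2 * a)" using \<alpha> a by (auto simp: \<theta>\<^sub>2_def)
  have "\<theta>\<^sub>2 * exp (2 * \<theta>\<^sub>2) * a * 1 \<le> \<alpha> / (2 * exp 2 * a) * exp 2 * a"
    unfolding mult_1_right using \<theta>\<^sub>2 a \<alpha> by (intro mult_mono) auto
  also have "\<dots> = \<alpha> / 2" using a by simp
  finally have small2: "\<theta>\<^sub>2 * exp (2 * \<theta>\<^sub>2) * a * 1 \<le> \<alpha> / 2" .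
  \<comment> \<open>For \<open>t > \<kappa> * n\<close> the exponent is at least
    \<open>c * n * ln n\<close>, hence \<open>3 * n\<close> once
    \<open>ln n \<ge> 3 / c\<close>.\<close>
  define c where "c = \<theta>\<^sub>2 * \<alpha> / 2 * (\<epsilon> * \<kappa>)"
  have c: "c > 0" using \<theta>\<^sub>2 \<alpha> \<epsilon> \<kappa> by (simp add: c_def)
  have lim1: "((\<lambda>n. a * ln (real n) / real n) \<longlongrightarrow> 0) sequentially" by real_asymp
  have ev1: "\<forall>\<^sub>F n in sequentially. a * ln (real n) / real n < 1"
    using order_tendstoD(2)[OF lim1, of 1] by simp
  have lim2: "filterlim (\<lambda>n. ln (real n)) at_top sequentially" by real_asymp
  have ev2: "\<forall>\<^sub>F n in sequentially. ln (real n) \<ge> 3 / c"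
    using lim2 unfolding filterlim_at_top by blast
  show ?thesis
    using ev1 ev2 eventually_ge_at_top[of 1]
  proof eventually_elim
    case (elim n)
    show ?case
    proof
      fix \<sigma>
      interpret sbm_params n a b \<sigma> using elim ab by unfold_locales auto
      \<comment> \<open>An empty \<open>T\<close> never violates the bound. Excluding it gives
        \<open>t \<ge> 1\<close>, which is what pays for the spare factor
        \<open>1 / n\<close>.\<close>
      define Q where "Q = {(S, T) \<in> Pow {..<n} \<times> Pow {..<n}. card S \<le> card T \<and> \<epsilon>\<^sup>2 * card T \<le> card S \<and> T \<noteq> {}}"
      define bad where "bad = (\<lambda>(S, T). {G.
         \<bar>\<Sum>i\<in>S. \<Sum>j\<in>T. adj_matrix G i j - sbm_mean n a b \<sigma> i j\<bar> > \<alpha> * ln n * sqrt (real (card S) * real (card T))})"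
      \<comment> \<open>The sum of the bounds for small and for large pairs, so that the union bound
        can run over all pairs without a case split.\<close>
      define \<pi> :: "nat set \<times> nat set \<Rightarrow> real" where
        "\<pi> = (\<lambda>(S, T). 2 * ((1 / n) * ((1 / n) ^ card S * (1 / n) ^ card T) + exp (- 3 * n)))"
      have QP: "Q \<subseteq> Pow {..<n} \<times> Pow {..<n}" by (auto simp: Q_def)
      have finQ: "finite Q" by (rule finite_subset[OF QP]) auto
      have pair: "measure_pmf.prob (sbm n a b \<sigma>) (bad ST) \<le> \<pi> ST" if "ST \<in> Q" for ST
      proof -
        obtain S T where ST: "ST = (S, T)" by fastforce
        define s where "s = real (card S)"
        define t where "t = real (card T)"
        define x where "x = sqrt (s * t)"
        have S: "S \<subseteq> {..<n}" and T: "T \<subseteq> {..<n}" "T \<noteq> {}" and st: "s \<le> t" "\<epsilon>\<^sup>2 * t \<le> s"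
          using that by (auto simp: Q_def ST s_def t_def)
        have finT: "finite T" using T finite_subset by blast
        have t1: "t \<ge> 1" using finT T by (simp add: t_def Suc_leI card_gt_0_iff)
        have tn: "t \<le> n" using card_mono[OF _ T(1)] by (simp add: t_def)
        have "x \<le> sqrt (t * t)" unfolding x_def using st t1 by (intro real_sqrt_le_mono mult_right_mono) auto
        then have xt: "x \<le> t" using t1 by simp
        have "sqrt ((\<epsilon> * t)\<^sup>2) \<le> x" unfolding x_def
          using st t1 mult_right_mono[of "\<epsilon>\<^sup>2 * t" s t]
          by (intro real_sqrt_le_mono) (auto simp: power2_eq_square mult_ac)
        then have xe: "\<epsilon> * t \<le> x" using t1 \<epsilon> by simp
        have "measure_pmf.prob (sbm n a b \<sigma>) (bad ST)
            \<le> 2 * ((1 / n) * ((1 / n) ^ card S * (1 / n) ^ card T)) \<or>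
          measure_pmf.prob (sbm n a b \<sigma>) (bad ST) \<le> 2 * exp (- 3 * n)"
        proof (cases "t \<le> \<kappa> * n")
          case True
          have "measure_pmf.prob (sbm n a b \<sigma>) (bad ST) \<le> 2 * exp (- (\<theta>\<^sub>1 * \<alpha> / 2) * ln n * x)"
            unfolding bad_def ST prod.case s_def[symmetric] t_def[symmetric] x_def[symmetric]
            using \<theta>\<^sub>1 \<kappa> xt True
            by (intro discrepancy_tail[OF S T(1), where \<kappa> = \<kappa>]) (auto simp: x_def s_def t_def)
          also have "- (\<theta>\<^sub>1 * \<alpha> / 2) * ln n * x \<le> - (1 + s + t) * ln n"
          proof -
            have "(1 + s + t) * ln n \<le> 3 * t * ln n"
              using st t1 ln_nonneg by (intro mult_right_mono) auto
            also have "\<dots> = (\<theta>\<^sub>1 * \<alpha> / 2) * ln n * (\<epsilon> * t)" using \<alpha> \<epsilon> by (simp add: \<theta>\<^sub>1_def)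
            also have "\<dots> \<le> (\<theta>\<^sub>1 * \<alpha> / 2) * ln n * x"
              using xe \<theta>\<^sub>1 \<alpha> ln_nonneg by (intro mult_left_mono) auto
            finally show ?thesis by (simp add: algebra_simps)
          qed
          also have "exp (- (1 + s + t) * ln n) = (1 / n) * ((1 / n) ^ card S * (1 / n) ^ card T)"
          proof -
            have "exp (- (1 + s + t) * ln n) = exp (- ln n) * (exp (card S * - ln n) * exp (card T * - ln n))"
              unfolding exp_add[symmetric] by (simp add: s_def t_def algebra_simps)
            also have "\<dots> = (1 / n) * ((1 / n) ^ card S * (1 / n) ^ card T)"
              unfolding exp_of_nat_mult using n_pos by (simp add: exp_minus field_simps)
            finally show ?thesis .
          qed
          finally show ?thesis by simp
        next
          case False
          have "measure_pmf.prob (sbm n a b \<sigma>) (bad ST) \<le> 2 * exp (- (\<theta>\<^sub>2 * \<alpha> / 2) * ln n * x)"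
            unfolding bad_def ST prod.case s_def[symmetric] t_def[symmetric] x_def[symmetric]
            using \<theta>\<^sub>2 small2 xt tn
            by (intro discrepancy_tail[OF S T(1), where \<kappa> = 1]) (auto simp: x_def s_def t_def)
          also have "- (\<theta>\<^sub>2 * \<alpha> / 2) * ln n * x \<le> - 3 * n"
          proof -
            have "3 * real n \<le> c * ln n * n" using elim(2) c by (intro mult_right_mono) (auto simp: field_simps)
            also have "\<dots> = (\<theta>\<^sub>2 * \<alpha> / 2) * ln n * (\<epsilon> * (\<kappa> * n))" by (simp add: c_def)
            also have "\<dots> \<le> (\<theta>\<^sub>2 * \<alpha> / 2) * ln n * (\<epsilon> * t)"
              using False \<epsilon> \<theta>\<^sub>2 \<alpha> ln_nonneg by (intro mult_left_mono) auto
            also have "\<dots> \<le> (\<theta>\<^sub>2 * \<alpha> / 2) * ln n * x"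
              using xe \<theta>\<^sub>2 \<alpha> ln_nonneg by (intro mult_left_mono) auto
            finally show ?thesis by simp
          qed
          finally show ?thesis by simp
        qed
        then show ?thesis
        proof
          assume "measure_pmf.prob (sbm n a b \<sigma>) (bad ST) \<le> 2 * ((1 / n) * ((1 / n) ^ card S * (1 / n) ^ card T))"
          also have "\<dots> \<le> \<pi> ST" by (simp add: \<pi>_def ST)
          finally show ?thesis .
        next
          assume "measure_pmf.prob (sbm n a b \<sigma>) (bad ST) \<le> 2 * exp (- 3 * n)"
          also have "\<dots> \<le> \<pi> ST" by (simp add: \<pi>_def ST)
          finally show ?thesis .
        qed
      qed
      let ?B = "{G. \<exists>S T. S \<subseteq> {..<n} \<and> T \<subseteq> {..<n} \<and> card S \<le> card T \<and> \<epsilon>\<^sup>2 * card T \<le> card S \<and>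
         \<bar>\<Sum>i\<in>S. \<Sum>j\<in>T. adj_matrix G i j - sbm_mean n a b \<sigma> i j\<bar> > \<alpha> * ln n * sqrt (real (card S) * real (card T))}"
      have "?B \<subseteq> (\<Union>ST\<in>Q. bad ST)"
      proof clarify
        fix G S T
        assume *: "S \<subseteq> {..<n}" "T \<subseteq> {..<n}" "card S \<le> card T" "\<epsilon>\<^sup>2 * card T \<le> card S"
          "\<bar>\<Sum>i\<in>S. \<Sum>j\<in>T. adj_matrix G i j - sbm_mean n a b \<sigma> i j\<bar> > \<alpha> * ln n * sqrt (real (card S) * real (card T))"
        then have "T \<noteq> {}" by auto
        with * show "G \<in> (\<Union>ST\<in>Q. bad ST)" by (intro UN_I[of "(S, T)"]) (auto simp: Q_def bad_def)
      qed
      then have "measure_pmf.prob (sbm n a b \<sigma>) ?B \<le> measure_pmf.prob (sbm n a b \<sigma>) (\<Union>ST\<in>Q. bad ST)"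
        by (intro measure_pmf.finite_measure_mono) auto
      also have "\<dots> \<le> (\<Sum>ST\<in>Q. measure_pmf.prob (sbm n a b \<sigma>) (bad ST))"
        by (intro measure_UNION_le finQ) auto
      also have "\<dots> \<le> (\<Sum>ST\<in>Q. \<pi> ST)" by (intro sum_mono pair)
      also have "\<dots> \<le> (\<Sum>ST\<in>Pow {..<n} \<times> Pow {..<n}. \<pi> ST)"
        by (intro sum_mono2 QP) (auto simp: \<pi>_def)
      also have "\<dots> = 2 * ((1 / n) * ((\<Sum>S\<in>Pow {..<n}. (1 / n) ^ card S) * (\<Sum>T\<in>Pow {..<n}. (1 / n) ^ card T))
          + (2 ^ n * 2 ^ n) * exp (- 3 * n))"
        unfolding \<pi>_def sum_distrib_left[symmetric] case_prod_unfold sum.distrib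
        by (simp add: sum_product sum.cartesian_product case_prod_unfold card_cartesian_product card_Pow)
      also have "\<dots> = 2 * ((1 / n) * ((1 + 1 / n) ^ n * (1 + 1 / n) ^ n) + (2 ^ n * 2 ^ n) * exp (- 3 * n))"
        by (simp add: sum_Pow_power_card)
      \<comment> \<open>Each generating function is at most e, hence 3; and
        \<open>4 ^ n * exp (- 3 * n)\<close> is at most \<open>exp (- n)\<close>, as 2 is below
        e.\<close>
      also have "\<dots> \<le> 2 * ((1 / n) * (3 * 3) + 1 / n)"
      proof -
        have "(1 + 1 / n) ^ n \<le> exp (1 / real n) ^ n"
          by (intro power_mono exp_ge_add_one_self) auto
        also have "\<dots> = exp 1" using n_pos by (simp add: exp_of_nat_mult[symmetric])
        finally have e3: "(1 + 1 / n) ^ n \<le> (3 :: real)" using exp_le by linarith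
        have "(2 :: real) \<le> exp 1" using exp_ge_add_one_self[of 1] by simp
        then have "(2 :: real) ^ n \<le> exp 1 ^ n" by (intro power_mono) auto
        then have "(2 :: real) ^ n \<le> exp n" by (simp add: exp_of_nat_mult[symmetric])
        then have "(2 ^ n * 2 ^ n) * exp (- 3 * real n) \<le> (exp n * exp n) * exp (- 3 * real n)"
          by (intro mult_right_mono mult_mono) auto
        also have "\<dots> = 1 / exp (real n)" by (simp add: exp_add[symmetric] exp_minus[symmetric] divide_inverse)
        also have "\<dots> \<le> 1 / n"
        proof -
          have "real n \<le> exp (real n)" using exp_ge_add_one_self[of "real n"] by linarith
          then show ?thesis using n_pos by (intro divide_left_mono) auto
        qed
        finally have e4: "(2 ^ n * 2 ^ n) * exp (- 3 * real n) \<le> 1 / n" .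
        show ?thesis using e3 e4 by (intro mult_left_mono add_mono mult_mono) auto
      qed
      also have "\<dots> = 20 / n" by (simp add: field_simps)
      finally show "measure_pmf.prob (sbm n a b \<sigma>) ?B \<le> 20 / n" .
    qed
  qed
qed

section \<open>Exact recovery\<close>

context sbm_params
begin

text \<open>Below the size ratio \<open>(\<alpha> / (C + a))\<^sup>2\<close> the row sum bound
  \<open>(C + a) * ln n * card S\<close> is already at most the required discrepancy, so
  \<open>disc\<close> is only assumed above it; symmetry of the matrix covers
  \<open>card S > card T\<close>.\<close>

lemma unique_opt_of_good_graph:
  assumes bal: "balanced_labelling r K \<sigma>" and n: "n = r * K" and r: "r \<ge> 2" and n2: "n \<ge> 2"
    and \<alpha>: "\<alpha> > 0" and C: "C > 0"
    and degree: "\<And>v. v < n \<Longrightarrow> (\<Sum>j<n. adj_matrix G v j) \<le> C * ln n"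
    and gap: "\<And>v l. v < n \<Longrightarrow> l < r \<Longrightarrow> l \<noteq> \<sigma> v \<Longrightarrow>
      (\<Sum>j | j < n \<and> \<sigma> j = l. adj_matrix G v j) + \<eta> * ln n \<le> (\<Sum>j | j < n \<and> \<sigma> j = \<sigma> v. adj_matrix G v j)"
    and disc: "\<And>S T. S \<subseteq> {..<n} \<Longrightarrow> T \<subseteq> {..<n} \<Longrightarrow> card S \<le> card T \<Longrightarrow>
      (\<alpha> / (C + a))\<^sup>2 * card T \<le> card S \<Longrightarrow>
      \<bar>\<Sum>i\<in>S. \<Sum>j\<in>T. adj_matrix G i j - sbm_mean n a b \<sigma> i j\<bar> \<le> \<alpha> * ln n * sqrt (real (card S) * real (card T))"
    and small: "16 * \<alpha> * (2 * real R + 1) + 2 * (C + a) / 2 ^ R + (real r + 1) * \<alpha> < \<eta>"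
  shows "sdp_unique_opt n K (adj_matrix G) (cluster_matrix \<sigma>)"
proof -
  define L where "L = ln (real n)"
  define D where "D = C + a"
  define M where "M i j = adj_matrix G i j - sbm_mean n a b \<sigma> i j" for i j
  have L: "L > 0" using n2 by (simp add: L_def)
  have D: "D > 0" using C a_pos by (simp add: D_def)
  have A_sym: "adj_matrix G i j = adj_matrix G j i" for i j by (auto simp: adj_matrix_def)
  have M_sym: "M i j = M j i" for i j
    unfolding M_def using A_sym[of i j] mean_matrix_sym[of _ _ \<sigma> i j] by simp
  have row: "(\<Sum>j<n. \<bar>M i j\<bar>) \<le> D * L" if "i < n" for i
  proof -
    have "(\<Sum>j<n. \<bar>M i j\<bar>) \<le> (\<Sum>j<n. adj_matrix G i j + a * L / n)"
    proof (rule sum_mono)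
      fix j
      show "\<bar>M i j\<bar> \<le> adj_matrix G i j + a * L / n"
        using mean_le[of i j] mean_nonneg[of i j] by (auto simp: M_def L_def adj_matrix_def)
    qed
    also have "\<dots> \<le> C * L + a * L" using degree[OF that] n_pos by (simp add: sum.distrib L_def)
    finally show ?thesis by (simp add: D_def algebra_simps)
  qed
  have disc1: "\<bar>\<Sum>i\<in>S. \<Sum>j\<in>T. M i j\<bar> \<le> \<alpha> * L * sqrt (real (card S) * real (card T))"
    if S: "S \<subseteq> {..<n}" and T: "T \<subseteq> {..<n}" and st: "card S \<le> card T" for S T
  proof (cases "(\<alpha> / D)\<^sup>2 * card T \<le> card S")
    case True
    then show ?thesis using disc[OF S T st] by (simp add: M_def L_def D_def)
  next
    case False
    have "\<bar>\<Sum>i\<in>S. \<Sum>j\<in>T. M i j\<bar> \<le> (\<Sum>i\<in>S. \<Sum>j\<in>T. \<bar>M i j\<bar>)"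
      by (intro order.trans[OF sum_abs] sum_mono sum_abs)
    also have "\<dots> \<le> (\<Sum>i\<in>S. \<Sum>j<n. \<bar>M i j\<bar>)"
      using T by (intro sum_mono sum_mono2) auto
    also have "\<dots> \<le> (\<Sum>i\<in>S. D * L)" using row S by (intro sum_mono) auto
    also have "\<dots> = D * L * card S" by simp
    also have "\<dots> \<le> D * L * (\<alpha> / D * sqrt (real (card S) * real (card T)))"
    proof (rule mult_left_mono)
      have "real (card S) * card S \<le> real (card S) * ((\<alpha> / D)\<^sup>2 * card T)"
        using False by (intro mult_left_mono) auto
      then have "sqrt (real (card S) * card S) \<le> sqrt ((\<alpha> / D)\<^sup>2 * (real (card S) * card T))"
        by (intro real_sqrt_le_mono) (simp add: mult_ac)
      then show "real (card S) \<le> \<alpha> / D * sqrt (real (card S) * real (card T))"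
        using \<alpha> D by (simp add: real_sqrt_mult real_sqrt_divide)
    qed (use D L in auto)
    finally show ?thesis using D by (simp add: mult_ac)
  qed
  have disc2: "\<bar>\<Sum>i\<in>S. \<Sum>j\<in>T. M i j\<bar> \<le> \<alpha> * L * sqrt (real (card S) * real (card T))"
    if S: "S \<subseteq> {..<n}" and T: "T \<subseteq> {..<n}" for S T
  proof (cases "card S \<le> card T")
    case False
    have "(\<Sum>i\<in>S. \<Sum>j\<in>T. M i j) = (\<Sum>j\<in>T. \<Sum>i\<in>S. M j i)"
      by (subst sum.swap) (simp add: M_sym)
    then show ?thesis using disc1[OF T S] False by (simp add: mult.commute)
  qed (rule disc1[OF S T])
  define \<gamma> where "\<gamma> = 16 * (\<alpha> * L) * (2 * R + 1) + 2 * (D * L) / 2 ^ R"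
  show ?thesis
  proof (rule sdp_unique_opt_of_regularity[OF bal n r, where \<beta> = "\<alpha> * L" and \<gamma> = \<gamma> and g = "\<eta> * L"])
    show "K > 0" using n2 n by (auto intro: gr0I)
    show "0 \<le> a * ln n / n" by (rule p_nonneg)
    show "0 \<le> \<alpha> * L" using \<alpha> L by simp
    show "adj_matrix G i j = adj_matrix G j i" for i j by (rule A_sym)
    show "\<bar>\<Sum>i\<in>S. \<Sum>j\<in>T. adj_matrix G i j - sbm_mean n a b \<sigma> i j\<bar> \<le> \<alpha> * L * sqrt (real (card S) * real (card T))"
      if "S \<subseteq> {..<n}" "T \<subseteq> {..<n}" for S T
      using disc2[OF that] by (simp add: M_def)
    show "(\<Sum>i<n. \<Sum>j<n. (adj_matrix G i j - sbm_mean n a b \<sigma> i j) * x i * x j) \<le> \<gamma> * (\<Sum>i<n. (x i)\<^sup>2)" for x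
      using quadratic_form_le_of_discrepancy[of n M "D * L" "\<alpha> * L" x R] M_sym row disc2 \<alpha> L
      by (simp add: M_def \<gamma>_def)
    show "(\<Sum>j | j < n \<and> \<sigma> j = l. adj_matrix G i j) + \<eta> * L \<le> (\<Sum>j | j < n \<and> \<sigma> j = \<sigma> i. adj_matrix G i j)"
      if "i < n" "l < r" "l \<noteq> \<sigma> i" for i l
      using gap[OF that] by (simp add: L_def)
    have "(16 * \<alpha> * (2 * R + 1) + 2 * D / 2 ^ R + (r + 1) * \<alpha>) * L < \<eta> * L"
      using small L by (intro mult_strict_right_mono) (simp_all add: D_def add_ac)
    then show "\<gamma> + (r + 1) * (\<alpha> * L) < \<eta> * L" by (simp add: \<gamma>_def algebra_simps)
  qed
qed

end

theorem theorem4: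
  fixes r :: nat and a b :: real
  assumes "r \<ge> 2" and "0 < b" and "b < a"
    and "sqrt a - sqrt b > sqrt (real r)"
  shows "\<exists>c > 0. \<exists>K0. \<forall>K \<ge> K0. \<forall>\<sigma>. balanced_labelling r K \<sigma> \<longrightarrow>
           measure_pmf.prob (sbm (r * K) a b \<sigma>)
             {G. sdp_unique_opt (r * K) K (adj_matrix G) (cluster_matrix \<sigma>)}
           \<ge> 1 - real (r * K) powr (- c)"
proof -
  define \<delta> where "\<delta> = (sqrt a - sqrt b)\<^sup>2 / r - 1"
  have "(sqrt r)\<^sup>2 < (sqrt a - sqrt b)\<^sup>2" using assms(4) by (intro power_strict_mono) auto
  then have \<delta>: "\<delta> > 0" using assms(1) by (simp add: \<delta>_def)
  define \<theta> where "\<theta> = ln (a / b) / 2"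
  have \<theta>: "\<theta> > 0" using assms by (simp add: \<theta>_def)
  \<comment> \<open>The margin spends half of the surplus:
    \<open>\<theta> * \<eta> = \<delta> / 2\<close>.\<close>
  define \<eta> where "\<eta> = \<delta> / (2 * \<theta>)"
  have \<eta>: "\<eta> > 0" "\<theta> * \<eta> = \<delta> / 2" using \<delta> \<theta> by (auto simp: \<eta>_def)
  \<comment> \<open>Makes the degree tail \<open>1 / n\<^sup>2\<close>, so that the union over
    vertices leaves \<open>1 / n\<close>.\<close>
  define C where "C = 2 * a + 2"
  define D where "D = C + a"
  have C: "C > 0" "D > 0" using assms by (auto simp: C_def D_def)
  \<comment> \<open>\<open>R\<close> pushes the contribution of far levels below
    \<open>\<eta> / 4\<close>. Then \<open>m\<close> is four times the coefficient of \<alpha> in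
    the remaining terms, so these add up to exactly \<open>\<eta> / 4\<close>.\<close>
  obtain R where R: "8 * D / \<eta> < 2 ^ R" using real_arch_pow[of 2 "8 * D / \<eta>"] by auto
  define m where "m = 64 * (2 * real R + 1) + 4 * (real r + 1)"
  have m: "m > 0" by (simp add: m_def add_pos_pos)
  define \<alpha> where "\<alpha> = \<eta> / m"
  have \<alpha>: "\<alpha> > 0" using \<eta> m by (simp add: \<alpha>_def)
  have small: "16 * \<alpha> * (2 * real R + 1) + 2 * (C + a) / 2 ^ R + (real r + 1) * \<alpha> < \<eta>"
  proof -
    have "\<alpha> * m = \<eta>" using m by (simp add: \<alpha>_def)
    then have "16 * \<alpha> * (2 * real R + 1) + (real r + 1) * \<alpha> = \<eta> / 4" by (simp add: m_def algebra_simps)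
    moreover have "2 * (C + a) / 2 ^ R < \<eta> / 4" using R \<eta> by (simp add: D_def field_simps)
    ultimately show ?thesis using \<eta> by linarith
  qed
  \<comment> \<open>Strictly below both failure exponents, 1 and \<open>\<delta> / 2\<close>, so
    that for large \<open>n\<close> the constants 21 and \<open>3 * r\<close> are absorbed.\<close>
  define c where "c = min (1 / 2) (\<delta> / 4)"
  have c: "c > 0" "c < 1" "c < \<delta> / 2" using \<delta> by (auto simp: c_def)
  have lim1: "((\<lambda>n. a * ln (real n) / real n) \<longlongrightarrow> 0) sequentially" by real_asymp
  have ev1: "\<forall>\<^sub>F n in sequentially. a * ln (real n) / real n < 1"
    using order_tendstoD(2)[OF lim1, of 1] by simp
  have "((\<lambda>n. real n powr (c - 1)) \<longlongrightarrow> 0) sequentially" "((\<lambda>n. real n powr (c - \<delta> / 2)) \<longlongrightarrow> 0) sequentially"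
    using c by (auto intro!: tendsto_neg_powr filterlim_real_sequentially)
  then have lim2: "((\<lambda>n. 21 * real n powr (c - 1) + 3 * real r * real n powr (c - \<delta> / 2)) \<longlongrightarrow> 21 * 0 + 3 * real r * 0) sequentially"
    by (intro tendsto_intros)
  have ev2: "\<forall>\<^sub>F n in sequentially. 21 * real n powr (c - 1) + 3 * real r * real n powr (c - \<delta> / 2) < 1"
    using order_tendstoD(2)[OF lim2, of 1] by simp
  note ev3 = sbm_discrepancy_comparable[OF assms(2) less_imp_le[OF assms(3)] \<alpha>, of "\<alpha> / D"]
  have "\<forall>\<^sub>F n in sequentially. a * ln (real n) / real n < 1 \<and>
      21 * real n powr (c - 1) + 3 * real r * real n powr (c - \<delta> / 2) < 1 \<and> n \<ge> 2 \<and>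
      (\<forall>\<sigma>. measure_pmf.prob (sbm n a b \<sigma>)
      {G. \<exists>S T. S \<subseteq> {..<n} \<and> T \<subseteq> {..<n} \<and> card S \<le> card T \<and> (\<alpha> / D)\<^sup>2 * card T \<le> card S \<and>
         \<bar>\<Sum>i\<in>S. \<Sum>j\<in>T. adj_matrix G i j - sbm_mean n a b \<sigma> i j\<bar> > \<alpha> * ln n * sqrt (real (card S) * real (card T))}
      \<le> 20 / n)"
    using ev1 ev2 ev3 C \<alpha> by (intro eventually_conj eventually_ge_at_top) auto
  then obtain N where N: "\<And>n. n \<ge> N \<Longrightarrow> a * ln (real n) / real n < 1 \<and>
      21 * real n powr (c - 1) + 3 * real r * real n powr (c - \<delta> / 2) < 1 \<and> n \<ge> 2 \<and>
      (\<forall>\<sigma>. measure_pmf.prob (sbm n a b \<sigma>)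
      {G. \<exists>S T. S \<subseteq> {..<n} \<and> T \<subseteq> {..<n} \<and> card S \<le> card T \<and> (\<alpha> / D)\<^sup>2 * card T \<le> card S \<and>
         \<bar>\<Sum>i\<in>S. \<Sum>j\<in>T. adj_matrix G i j - sbm_mean n a b \<sigma> i j\<bar> > \<alpha> * ln n * sqrt (real (card S) * real (card T))}
      \<le> 20 / n)" unfolding eventually_sequentially by blast
  show ?thesis
  proof (intro exI[of _ c] conjI exI[of _ N] allI impI)
    show "c > 0" by fact
    fix K \<sigma> assume K: "K \<ge> N" and bal: "balanced_labelling r K \<sigma>"
    define n where "n = r * K"
    have "K \<le> n" using assms(1) by (simp add: n_def)
    note Nn = N[OF order.trans[OF K this]]
    have n2: "n \<ge> 2" using Nn by blast
    interpret sbm_params n a b \<sigma> using Nn n2 assms by unfold_locales auto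
    define P where "P = measure_pmf.prob (sbm n a b \<sigma>)"
    define B\<^sub>1 where "B\<^sub>1 = (\<Union>v\<in>{..<n}. {G. C * ln n \<le> (\<Sum>j<n. adj_matrix G v j)})"
    define I where "I = {(v, l) \<in> {..<n} \<times> {..<r}. l \<noteq> \<sigma> v}"
    define gapless where "gapless = (\<lambda>(v, l). {G. \<not> (\<Sum>j | j < n \<and> \<sigma> j = l. adj_matrix G v j) + \<eta> * ln n
        \<le> (\<Sum>j | j < n \<and> \<sigma> j = \<sigma> v. adj_matrix G v j)})"
    define B\<^sub>2 where "B\<^sub>2 = (\<Union>x\<in>I. gapless x)"
    define B\<^sub>3 where "B\<^sub>3 = {G. \<exists>S T. S \<subseteq> {..<n} \<and> T \<subseteq> {..<n} \<and> card S \<le> card T \<and> (\<alpha> / D)\<^sup>2 * card T \<le> card S \<and>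
         \<bar>\<Sum>i\<in>S. \<Sum>j\<in>T. adj_matrix G i j - sbm_mean n a b \<sigma> i j\<bar> > \<alpha> * ln n * sqrt (real (card S) * real (card T))}"
    have exp_ln: "exp (- ln (real n)) = 1 / n" using n2 by (simp add: exp_minus field_simps)
    have "P B\<^sub>1 \<le> (\<Sum>v<n. P {G. C * ln n \<le> (\<Sum>j<n. adj_matrix G v j)})"
      unfolding P_def B\<^sub>1_def by (intro measure_UNION_le) auto
    also have "\<dots> \<le> (\<Sum>v<n. exp ((2 * a - C) * ln n))"
      unfolding P_def by (intro sum_mono degree_tail) auto
    also have "exp ((2 * a - C) * ln n) = (1 / n) * (1 / n)"
      unfolding exp_ln[symmetric] exp_add[symmetric] by (simp add: C_def)
    finally have P1: "P B\<^sub>1 \<le> 1 / n" using n2 by simp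
    have I: "I \<subseteq> {..<n} \<times> {..<r}" by (auto simp: I_def)
    have finI: "finite I" by (rule finite_subset[OF I]) simp
    have "P B\<^sub>2 \<le> (\<Sum>x\<in>I. P (gapless x))"
      unfolding P_def B\<^sub>2_def by (intro measure_UNION_le finI) auto
    also have "\<dots> \<le> (\<Sum>x\<in>I. exp (1 + \<theta> * (\<eta> * ln n) - (sqrt a - sqrt b)\<^sup>2 / r * ln n))"
      unfolding P_def
    proof (intro sum_mono)
      fix x assume "x \<in> I"
      then show "measure_pmf.prob (sbm n a b \<sigma>) (gapless x)
          \<le> exp (1 + \<theta> * (\<eta> * ln n) - (sqrt a - sqrt b)\<^sup>2 / r * ln n)"
        using gap_tail[OF bal n_def _ _ _ assms(3) \<theta>_def] by (auto simp: I_def gapless_def)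
    qed
    also have "\<dots> \<le> (\<Sum>x\<in>{..<n} \<times> {..<r}. exp (1 + \<theta> * (\<eta> * ln n) - (sqrt a - sqrt b)\<^sup>2 / r * ln n))"
      by (intro sum_mono2 I) auto
    also have "\<dots> = n * r * exp (1 + \<theta> * (\<eta> * ln n) - (sqrt a - sqrt b)\<^sup>2 / r * ln n)"
      by (simp add: card_cartesian_product)
    also have "1 + \<theta> * (\<eta> * ln n) - (sqrt a - sqrt b)\<^sup>2 / r * ln n = 1 + (- ln n + (- (\<delta> / 2)) * ln n)"
    proof -
      have "(sqrt a - sqrt b)\<^sup>2 / r = 1 + \<delta>" by (simp add: \<delta>_def)
      moreover have "\<theta> * (\<eta> * ln n) = \<delta> / 2 * ln n" using \<eta>(2) by (metis mult.assoc)
      ultimately show ?thesis by (simp add: algebra_simps)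
    qed
    also have "exp (1 + (- ln n + (- (\<delta> / 2)) * ln n)) = exp 1 * ((1 / n) * n powr (- (\<delta> / 2)))"
      unfolding exp_add exp_ln using n2 by (simp add: powr_def)
    also have "n * r * (exp 1 * ((1 / n) * n powr (- (\<delta> / 2)))) = exp 1 * (r * n powr (- (\<delta> / 2)))"
      using n2 by simp
    also have "\<dots> \<le> 3 * (r * n powr (- (\<delta> / 2)))" using exp_le by (intro mult_right_mono) auto
    finally have P2: "P B\<^sub>2 \<le> 3 * r * n powr (- (\<delta> / 2))" by simp
    have P3: "P B\<^sub>3 \<le> 20 / n" unfolding P_def B\<^sub>3_def using Nn by blast
    have "P (B\<^sub>1 \<union> B\<^sub>2 \<union> B\<^sub>3) \<le> P B\<^sub>1 + P B\<^sub>2 + P B\<^sub>3"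
      unfolding P_def
      by (intro order.trans[OF measure_Un_le] add_right_mono measure_Un_le) auto
    also have "\<dots> \<le> 21 / n + 3 * r * n powr (- (\<delta> / 2))" using P1 P2 P3 by simp
    also have "\<dots> = n powr (- c) * (21 * real n powr (c - 1) + 3 * real r * real n powr (c - \<delta> / 2))"
    proof -
      have "n powr (- c) * n powr (c - 1) = 1 / n" "n powr (- c) * n powr (c - \<delta> / 2) = n powr (- (\<delta> / 2))"
        unfolding powr_add[symmetric] using n2 by (simp_all add: powr_minus_divide)
      then show ?thesis by (simp add: distrib_left mult.left_commute[of "n powr (- c)"] del: powr_minus)
    qed
    also have "\<dots> \<le> n powr (- c) * 1" using Nn by (intro mult_left_mono) auto
    finally have PB: "P (B\<^sub>1 \<union> B\<^sub>2 \<union> B\<^sub>3) \<le> n powr (- c)" by simp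
    have good: "sdp_unique_opt n K (adj_matrix G) (cluster_matrix \<sigma>)" if G: "G \<notin> B\<^sub>1 \<union> B\<^sub>2 \<union> B\<^sub>3" for G
    proof (rule unique_opt_of_good_graph[OF bal n_def assms(1) n2 \<alpha> C(1) _ _ _ small])
      show "(\<Sum>j<n. adj_matrix G v j) \<le> C * ln n" if "v < n" for v
        using G that by (force simp: B\<^sub>1_def)
      show "(\<Sum>j | j < n \<and> \<sigma> j = l. adj_matrix G v j) + \<eta> * ln n \<le> (\<Sum>j | j < n \<and> \<sigma> j = \<sigma> v. adj_matrix G v j)"
        if "v < n" "l < r" "l \<noteq> \<sigma> v" for v l
        using G that by (force simp: B\<^sub>2_def I_def gapless_def)
      show "\<bar>\<Sum>i\<in>S. \<Sum>j\<in>T. adj_matrix G i j - sbm_mean n a b \<sigma> i j\<bar> \<le> \<alpha> * ln n * sqrt (real (card S) * real (card T))"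
        if "S \<subseteq> {..<n}" "T \<subseteq> {..<n}" "card S \<le> card T" "(\<alpha> / (C + a))\<^sup>2 * card T \<le> card S" for S T
      proof (rule ccontr)
        assume "\<not> ?thesis"
        then have "G \<in> B\<^sub>3" using that unfolding B\<^sub>3_def D_def[symmetric] not_le by blast
        then show False using G by simp
      qed
    qed
    have "1 - n powr (- c) \<le> 1 - P (B\<^sub>1 \<union> B\<^sub>2 \<union> B\<^sub>3)" using PB by simp
    also have "\<dots> = P (UNIV - (B\<^sub>1 \<union> B\<^sub>2 \<union> B\<^sub>3))"
      unfolding P_def using measure_pmf.prob_compl[of "B\<^sub>1 \<union> B\<^sub>2 \<union> B\<^sub>3" "sbm n a b \<sigma>"] by simp
    also have "\<dots> \<le> P {G. sdp_unique_opt n K (adj_matrix G) (cluster_matrix \<sigma>)}"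
      unfolding P_def using good by (intro measure_pmf.finite_measure_mono) auto
    finally show "1 - real (r * K) powr (- c) \<le> measure_pmf.prob (sbm (r * K) a b \<sigma>)
             {G. sdp_unique_opt (r * K) K (adj_matrix G) (cluster_matrix \<sigma>)}"
      by (simp add: P_def n_def)
  qed
qed

end
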